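(* Let $L$ be a Latin square of order $n \geq 3$. Let $p_{\max}$ be the number of maximal partial transversals of deficit $1$ in $L$, let $q_{\min}$ be the number of minimal $(n+1)$-covers of $L$, and let $q_1,\dots,q_5$ be as defined in the context. Then $q_{\min} = q_1 + q_2 + q_3 + q_5$ and $$0 \leq \frac{2(q_{\min}-q_1)}{3n-4} \leq p_{\max} \leq \frac{2(q_{\min}-q_1)}{3n-6} \leq \frac{2q_{\min}}{3n-6}.$$ Moreover, if $t$ is the number of transversals of $L$, $p$ is the number of (not necessarily maximal) partial transversals of deficit $1$ of $L$, and $q$ is the number of (not necessarily minimal) $(n+1)$-covers of $L$, then $$p \leq \frac{2q+n(n-4)t}{3n-6}.$$
   Context: A Latin square of order $n$ is an $n\times n$ array on $n$ symbols in which each symbol occurs once in each row and each column; its set of entries is $E(L)=\{(i,j,L_{ij})\}$. A line is the set of all entries in a given row, in a given column, or with a given symbol. A cover is a subset of $E(L)$ meeting every line; an $(n+1)$-cover is a cover of size $n+1$; a cover $\mathscr{C}$ is minimal if $\mathscr{C}\setminus\{\mathbf{e}\}$ is not a cover for all $\mathbf{e}\in\mathscr{C}$. A partial transversal of deficit $d$ is an $(n-d)$-subset of $E(L)$ in which every line is represented at most once; a transversal is one of deficit $0$; a partial transversal is maximal if adding any further entry destroys this property. The Latin square graph $\Gamma_L$ has vertex set $E(L)$, two distinct entries adjacent when they share a row, a column or a symbol. For an $(n+1)$-cover $\mathscr{C}$, the subgraph of $\Gamma_L$ induced by $\mathscr{C}$ has exactly three edges; after deleting isolated vertices it is isomorphic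 to one of: $G_1$ = three disjoint edges ($3K_2$); $G_2$ = disjoint union of a path with 2 edges and a single edge ($P_3\cup K_2$); $G_3$ = a path with 3 edges ($P_4$); $G_4$ = the star $K_{1,3}$; $G_5$ = a triangle $K_3$. For $i\in\{1,\dots,5\}$, $q_i$ is the number of $(n+1)$-covers of $L$ whose induced graph (ignoring isolated vertices) is isomorphic to $G_i$. *)

theory Defs imports Complex_Main begin

section \<open>Latin squares\<close>

text \<open>Rows and columns are indexed by \<open>{..<n}\<close>; the \<open>n\<close> symbols form an arbitrary set \<open>S\<close>.
  Values of \<open>L\<close> outside \<open>{..<n} \<times> {..<n}\<close> are irrelevant.\<close>

definition latin_square :: "nat \<Rightarrow> 's set \<Rightarrow> (nat \<Rightarrow> nat \<Rightarrow> 's) \<Rightarrow> bool" where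
  "latin_square n S L \<longleftrightarrow>
     finite S \<and> card S = n \<and>
     (\<forall>i<n. \<forall>j<n. L i j \<in> S) \<and>
     (\<forall>i<n. \<forall>s\<in>S. \<exists>!j. j < n \<and> L i j = s) \<and>
     (\<forall>j<n. \<forall>s\<in>S. \<exists>!i. i < n \<and> L i j = s)"

type_synonym 's entry = "nat \<times> nat \<times> 's"

definition row_of :: "'s entry \<Rightarrow> nat" where
  "row_of e = fst e"

definition col_of :: "'s entry \<Rightarrow> nat" where
  "col_of e = fst (snd e)"

definition sym_of :: "'s entry \<Rightarrow> 's" where
  "sym_of e = snd (snd e)"

definition entries :: "nat \<Rightarrow> (nat \<Rightarrow> nat \<Rightarrow> 's) \<Rightarrow> 's entry set" where
  "entries n L = {(i, j, L i j) | i j. i < n \<and> j < n}"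

definition lines :: "nat \<Rightarrow> 's set \<Rightarrow> (nat \<Rightarrow> nat \<Rightarrow> 's) \<Rightarrow> 's entry set set" where
  "lines n S L =
     {{e \<in> entries n L. row_of e = i} | i. i < n} \<union>
     {{e \<in> entries n L. col_of e = j} | j. j < n} \<union>
     {{e \<in> entries n L. sym_of e = s} | s. s \<in> S}"

section \<open>Covers and partial transversals\<close>

definition cover :: "nat \<Rightarrow> 's set \<Rightarrow> (nat \<Rightarrow> nat \<Rightarrow> 's) \<Rightarrow> 's entry set \<Rightarrow> bool" where
  "cover n S L C \<longleftrightarrow> C \<subseteq> entries n L \<and> (\<forall>l \<in> lines n S L. C \<inter> l \<noteq> {})"

definition minimal_cover :: "nat \<Rightarrow> 's set \<Rightarrow> (nat \<Rightarrow> nat \<Rightarrow> 's) \<Rightarrow> 's entry set \<Rightarrow> bool" where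
  "minimal_cover n S L C \<longleftrightarrow> cover n S L C \<and> (\<forall>e \<in> C. \<not> cover n S L (C - {e}))"

definition lines_at_most_once ::
    "nat \<Rightarrow> 's set \<Rightarrow> (nat \<Rightarrow> nat \<Rightarrow> 's) \<Rightarrow> 's entry set \<Rightarrow> bool" where
  "lines_at_most_once n S L P \<longleftrightarrow> (\<forall>l \<in> lines n S L. card (P \<inter> l) \<le> 1)"

text \<open>The size condition \<open>card P = n - d\<close> is written additively to avoid truncated subtraction.\<close>

definition partial_transversal ::
    "nat \<Rightarrow> 's set \<Rightarrow> (nat \<Rightarrow> nat \<Rightarrow> 's) \<Rightarrow> nat \<Rightarrow> 's entry set \<Rightarrow> bool" where
  "partial_transversal n S L d P \<longleftrightarrow>
     P \<subseteq> entries n L \<and> card P + d = n \<and> lines_at_most_once n S L P"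

definition transversal :: "nat \<Rightarrow> 's set \<Rightarrow> (nat \<Rightarrow> nat \<Rightarrow> 's) \<Rightarrow> 's entry set \<Rightarrow> bool" where
  "transversal n S L P \<longleftrightarrow> partial_transversal n S L 0 P"

text \<open>Maximality concerns the property that every line is represented at most once: enlarging
  \<open>P\<close> changes its size, so the deficit is not part of the property that has to be destroyed.\<close>

definition maximal_partial_transversal ::
    "nat \<Rightarrow> 's set \<Rightarrow> (nat \<Rightarrow> nat \<Rightarrow> 's) \<Rightarrow> nat \<Rightarrow> 's entry set \<Rightarrow> bool" where
  "maximal_partial_transversal n S L d P \<longleftrightarrow>
     partial_transversal n S L d P \<and>
     (\<forall>e \<in> entries n L - P. \<not> lines_at_most_once n S L (insert e P))"

section \<open>Simple graphs and the Latin square graph\<close>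

text \<open>A simple graph is a pair of a vertex set and a set of two-element sets of vertices.\<close>

type_synonym 'v ugraph = "'v set \<times> 'v set set"

definition induced_subgraph :: "'v ugraph \<Rightarrow> 'v set \<Rightarrow> 'v ugraph" where
  "induced_subgraph G W = (W, {e \<in> snd G. e \<subseteq> W})"

definition delete_isolated :: "'v ugraph \<Rightarrow> 'v ugraph" where
  "delete_isolated G = ({v \<in> fst G. \<exists>e \<in> snd G. v \<in> e}, snd G)"

definition graph_isomorphic :: "'v ugraph \<Rightarrow> 'w ugraph \<Rightarrow> bool" where
  "graph_isomorphic G H \<longleftrightarrow>
     (\<exists>f. bij_betw f (fst G) (fst H) \<and>
          (\<forall>u \<in> fst G. \<forall>v \<in> fst G. {u, v} \<in> snd G \<longleftrightarrow> {f u, f v} \<in> snd H))"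

definition latin_square_graph :: "nat \<Rightarrow> (nat \<Rightarrow> nat \<Rightarrow> 's) \<Rightarrow> 's entry ugraph" where
  "latin_square_graph n L =
     (entries n L,
      {{e, f} | e f. e \<in> entries n L \<and> f \<in> entries n L \<and> e \<noteq> f \<and>
         (row_of e = row_of f \<or> col_of e = col_of f \<or> sym_of e = sym_of f)})"

text \<open>\<open>3K\<^sub>2\<close>, \<open>P\<^sub>3 \<union> K\<^sub>2\<close>, \<open>P\<^sub>4\<close>, \<open>K\<^sub>1\<^sub>,\<^sub>3\<close> and \<open>K\<^sub>3\<close>, in this order.\<close>

definition G1 :: "nat ugraph" where
  "G1 = ({0, 1, 2, 3, 4, 5}, {{0, 1}, {2, 3}, {4, 5}})"

definition G2 :: "nat ugraph" where
  "G2 = ({0, 1, 2, 3, 4}, {{0, 1}, {1, 2}, {3, 4}})"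

definition G3 :: "nat ugraph" where
  "G3 = ({0, 1, 2, 3}, {{0, 1}, {1, 2}, {2, 3}})"

definition G4 :: "nat ugraph" where
  "G4 = ({0, 1, 2, 3}, {{0, 1}, {0, 2}, {0, 3}})"

definition G5 :: "nat ugraph" where
  "G5 = ({0, 1, 2}, {{0, 1}, {1, 2}, {0, 2}})"

section \<open>The counted quantities\<close>

definition num_transversals :: "nat \<Rightarrow> 's set \<Rightarrow> (nat \<Rightarrow> nat \<Rightarrow> 's) \<Rightarrow> nat" where
  "num_transversals n S L = card {P. transversal n S L P}"

definition num_partial_transversals ::
    "nat \<Rightarrow> 's set \<Rightarrow> (nat \<Rightarrow> nat \<Rightarrow> 's) \<Rightarrow> nat \<Rightarrow> nat" where
  "num_partial_transversals n S L d = card {P. partial_transversal n S L d P}"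

definition num_maximal_partial_transversals ::
    "nat \<Rightarrow> 's set \<Rightarrow> (nat \<Rightarrow> nat \<Rightarrow> 's) \<Rightarrow> nat \<Rightarrow> nat" where
  "num_maximal_partial_transversals n S L d = card {P. maximal_partial_transversal n S L d P}"

definition num_covers :: "nat \<Rightarrow> 's set \<Rightarrow> (nat \<Rightarrow> nat \<Rightarrow> 's) \<Rightarrow> nat \<Rightarrow> nat" where
  "num_covers n S L k = card {C. cover n S L C \<and> card C = k}"

definition num_minimal_covers :: "nat \<Rightarrow> 's set \<Rightarrow> (nat \<Rightarrow> nat \<Rightarrow> 's) \<Rightarrow> nat \<Rightarrow> nat" where
  "num_minimal_covers n S L k = card {C. minimal_cover n S L C \<and> card C = k}"

definition num_covers_of_type ::
    "nat \<Rightarrow> 's set \<Rightarrow> (nat \<Rightarrow> nat \<Rightarrow> 's) \<Rightarrow> nat \<Rightarrow> nat ugraph \<Rightarrow> nat" where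
  "num_covers_of_type n S L k G =
     card {C. cover n S L C \<and> card C = k \<and>
              graph_isomorphic
                (delete_isolated (induced_subgraph (latin_square_graph n L) C)) G}"

end

theory Submission imports Defs begin

text \<open>An \<open>(n + 1)\<close>-cover repeats exactly one row, one column and one symbol, so its three edges are
  distinct, and an entry is redundant iff it lies on all three: the non-minimal covers are those of
  type \<open>G4\<close>. Removing two entries that meet all three edges leaves a partial transversal of
  deficit \<open>1\<close>, which is maximal exactly when the cover is minimal; a cover of type \<open>G1\<close>, \<open>G2\<close>,
  \<open>G3\<close>, \<open>G5\<close> admits \<open>0\<close>, \<open>2\<close>, \<open>3\<close>, \<open>3\<close> such removals. Conversely, a maximal partial transversal of
  deficit \<open>1\<close> lies in exactly \<open>3n - 3\<close> covers, between \<open>3\<close> and \<open>9\<close> of which have type \<open>G3\<close> or \<open>G5\<close>.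
  Hence \<open>(3n - 3) p\<^sub>m\<^sub>a\<^sub>x = 2 q\<^sub>2 + 3 (q\<^sub>3 + q\<^sub>5)\<close> with \<open>p\<^sub>m\<^sub>a\<^sub>x \<le> q\<^sub>3 + q\<^sub>5 \<le> 3 p\<^sub>m\<^sub>a\<^sub>x\<close>. The last bound follows
  because a non-maximal partial transversal of deficit \<open>1\<close> is a transversal minus an entry, while
  adding any other entry to a transversal gives a non-minimal cover.\<close>

section \<open>Graphs with three edges\<close>

abbreviation edge_graph :: "'v set set \<Rightarrow> 'v ugraph" where
  "edge_graph E \<equiv> (\<Union>E, E)"

text \<open>An isomorphism onto a concrete pattern, turned around, is an injective naming
  \<open>g\<close> of the pattern's vertices. Since \<open>graph_isomorphic\<close> only tests sets
  of the form \<open>{u, v}\<close> with both vertices present, edge sets can be compared as wholes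
  only when all edges have that shape.\<close>

lemma graph_isomorphic_iff:
  assumes E: "\<forall>e\<in>E. \<exists>u v. e = {u, v}" "\<Union>E \<subseteq> V"
    and F: "\<forall>e\<in>F. \<exists>u v. e = {u, v}" "\<Union>F \<subseteq> W"
  shows "graph_isomorphic (V, E) (W, F) \<longleftrightarrow>
    (\<exists>g. inj_on g W \<and> V = g ` W \<and> E = (`) g ` F)"
proof
  assume "graph_isomorphic (V, E) (W, F)"
  then obtain f where f: "bij_betw f V W"
    and ed: "\<And>u v. u \<in> V \<Longrightarrow> v \<in> V \<Longrightarrow> {u, v} \<in> E \<longleftrightarrow> {f u, f v} \<in> F"
    unfolding graph_isomorphic_def by auto
  define g where "g = inv_into V f"
  have g: "bij_betw g W V"
    unfolding g_def by (rule bij_betw_inv_into[OF f])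
  have gf: "g (f u) = u" if "u \<in> V" for u
    unfolding g_def using f that by (simp add: bij_betw_inv_into_left)
  have fg: "f (g x) = x" "g x \<in> V" if "x \<in> W" for x
    using f g that by (auto simp: g_def bij_betw_inv_into_right bij_betw_def)
  have "e \<in> (`) g ` F" if e: "e \<in> E" for e
  proof -
    obtain u v where uv: "e = {u, v}" using E(1) e by blast
    then have "u \<in> V" "v \<in> V" using e E(2) by auto
    then have "{f u, f v} \<in> F" "e = g ` {f u, f v}" using ed e uv gf by auto
    then show ?thesis by blast
  qed
  moreover have "g ` e \<in> E" if e: "e \<in> F" for e
  proof -
    obtain x y where xy: "e = {x, y}" using F(1) e by blast
    then have "x \<in> W" "y \<in> W" using e F(2) by auto
    then show ?thesis using ed[of "g x" "g y"] fg e xy by auto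
  qed
  ultimately show "\<exists>g. inj_on g W \<and> V = g ` W \<and> E = (`) g ` F"
    using g unfolding bij_betw_def by blast
next
  assume "\<exists>g. inj_on g W \<and> V = g ` W \<and> E = (`) g ` F"
  then obtain g where g: "inj_on g W" "V = g ` W" "E = (`) g ` F" by blast
  define f where "f = inv_into W g"
  have f: "bij_betw f V W"
    unfolding f_def using g by (intro bij_betw_inv_into) (simp add: bij_betw_def)
  have "{u, v} \<in> E \<longleftrightarrow> {f u, f v} \<in> F" if "u \<in> V" "v \<in> V" for u v
  proof -
    obtain x y where xy: "x \<in> W" "y \<in> W" "u = g x" "v = g y" using \<open>u \<in> V\<close> \<open>v \<in> V\<close> g by auto
    have "{u, v} \<in> E \<longleftrightarrow> (\<exists>e\<in>F. g ` {x, y} = g ` e)" using g xy by auto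
    also have "\<dots> \<longleftrightarrow> (\<exists>e\<in>F. {x, y} = e)"
      using inj_on_image_eq_iff[OF g(1), of "{x, y}"] F(2) xy by blast
    finally show ?thesis using xy g by (simp add: f_def)
  qed
  then show "graph_isomorphic (V, E) (W, F)"
    unfolding graph_isomorphic_def using f by auto
qed

text \<open>The list is the naming: pattern vertex \<open>i\<close> receives the name
  \<open>xs ! i\<close>. This reduces each isomorphism with a concrete pattern to
  evaluation.\<close>

lemma graph_isomorphic_listI:
  assumes "distinct xs" "\<Union>F = {..<length xs}" "\<forall>e\<in>F. \<exists>u v. e = {u, v}"
    and "E = (`) ((!) xs) ` F"
  shows "graph_isomorphic (edge_graph E) (edge_graph F)"
proof -
  have "inj_on ((!) xs) (\<Union>F)"
    using assms(1,2) by (auto simp: inj_on_def nth_eq_iff_index_eq)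
  moreover have "\<Union>E = (!) xs ` \<Union>F" using assms(4) by auto
  moreover have "\<exists>u v. e = {u, v}" if "e \<in> E" for e
  proof -
    obtain d where d: "d \<in> F" "e = (!) xs ` d" using \<open>e \<in> E\<close> assms(4) by blast
    then obtain u v where "d = {u, v}" using assms(3) by blast
    then show ?thesis using d by auto
  qed
  ultimately show ?thesis
    using assms by (subst graph_isomorphic_iff) auto
qed

lemma graph_isomorphic_edge_imageE:
  assumes "graph_isomorphic (edge_graph E) (edge_graph F)"
    and "\<forall>e\<in>E. \<exists>u v. e = {u, v}" "\<forall>e\<in>F. \<exists>u v. e = {u, v}"
  obtains g where "inj_on g (\<Union>F)" "E = (`) g ` F"
  using assms by (subst (asm) graph_isomorphic_iff) auto

section \<open>The five types in terms of named vertices\<close>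

lemma edge_graph_G:
  "G1 = edge_graph {{0, 1}, {2, 3}, {4, 5}}" "G2 = edge_graph {{0, 1}, {1, 2}, {3, 4}}"
  "G3 = edge_graph {{0, 1}, {1, 2}, {2, 3}}" "G4 = edge_graph {{0, 1}, {0, 2}, {0, 3}}"
  "G5 = edge_graph {{0, 1}, {1, 2}, {0, 2}}"
  by (auto simp: G1_def G2_def G3_def G4_def G5_def)

lemma isomorphic_G1I:
  assumes "distinct [a, b, c, d, e, f]"
  shows "graph_isomorphic (edge_graph {{a, b}, {c, d}, {e, f}}) G1"
  unfolding edge_graph_G using assms
  by (intro graph_isomorphic_listI[of "[a, b, c, d, e, f]"]) (auto simp: lessThan_nat_numeral lessThan_Suc)

lemma isomorphic_G1E:
  assumes "graph_isomorphic (edge_graph E) G1" "\<forall>e\<in>E. \<exists>u v. e = {u, v}"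
  obtains a b c d e f where "distinct [a, b, c, d, e, f]" "E = {{a, b}, {c, d}, {e, f}}"
proof -
  obtain g where "inj_on g (\<Union>{{0::nat, 1}, {2, 3}, {4, 5}})" "E = (`) g ` {{0::nat, 1}, {2, 3}, {4, 5}}"
    using assms unfolding edge_graph_G by (rule graph_isomorphic_edge_imageE) auto
  then show thesis
    by (intro that[of "g 0" "g 1" "g 2" "g 3" "g 4" "g 5"]) (simp_all add: inj_on_def)
qed

lemma isomorphic_G2I:
  assumes "distinct [a, b, c, d, e]"
  shows "graph_isomorphic (edge_graph {{a, b}, {b, c}, {d, e}}) G2"
  unfolding edge_graph_G using assms
  by (intro graph_isomorphic_listI[of "[a, b, c, d, e]"]) (auto simp: lessThan_nat_numeral lessThan_Suc)

lemma isomorphic_G2E: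
  assumes "graph_isomorphic (edge_graph E) G2" "\<forall>e\<in>E. \<exists>u v. e = {u, v}"
  obtains a b c d e where "distinct [a, b, c, d, e]" "E = {{a, b}, {b, c}, {d, e}}"
proof -
  obtain g where "inj_on g (\<Union>{{0::nat, 1}, {1, 2}, {3, 4}})" "E = (`) g ` {{0::nat, 1}, {1, 2}, {3, 4}}"
    using assms unfolding edge_graph_G by (rule graph_isomorphic_edge_imageE) auto
  then show thesis
    by (intro that[of "g 0" "g 1" "g 2" "g 3" "g 4"]) (simp_all add: inj_on_def)
qed

lemma isomorphic_G3I:
  assumes "distinct [a, b, c, d]"
  shows "graph_isomorphic (edge_graph {{a, b}, {b, c}, {c, d}}) G3"
  unfolding edge_graph_G using assms
  by (intro graph_isomorphic_listI[of "[a, b, c, d]"]) (auto simp: lessThan_nat_numeral lessThan_Suc)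

lemma isomorphic_G3E:
  assumes "graph_isomorphic (edge_graph E) G3" "\<forall>e\<in>E. \<exists>u v. e = {u, v}"
  obtains a b c d where "distinct [a, b, c, d]" "E = {{a, b}, {b, c}, {c, d}}"
proof -
  obtain g where "inj_on g (\<Union>{{0::nat, 1}, {1, 2}, {2, 3}})" "E = (`) g ` {{0::nat, 1}, {1, 2}, {2, 3}}"
    using assms unfolding edge_graph_G by (rule graph_isomorphic_edge_imageE) auto
  then show thesis
    by (intro that[of "g 0" "g 1" "g 2" "g 3"]) (simp_all add: inj_on_def)
qed

lemma isomorphic_G4I:
  assumes "distinct [a, b, c, d]"
  shows "graph_isomorphic (edge_graph {{a, b}, {a, c}, {a, d}}) G4"
  unfolding edge_graph_G using assms
  by (intro graph_isomorphic_listI[of "[a, b, c, d]"]) (auto simp: lessThan_nat_numeral lessThan_Suc)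

lemma isomorphic_G4E:
  assumes "graph_isomorphic (edge_graph E) G4" "\<forall>e\<in>E. \<exists>u v. e = {u, v}"
  obtains a b c d where "distinct [a, b, c, d]" "E = {{a, b}, {a, c}, {a, d}}"
proof -
  obtain g where "inj_on g (\<Union>{{0::nat, 1}, {0, 2}, {0, 3}})" "E = (`) g ` {{0::nat, 1}, {0, 2}, {0, 3}}"
    using assms unfolding edge_graph_G by (rule graph_isomorphic_edge_imageE) auto
  then show thesis
    by (intro that[of "g 0" "g 1" "g 2" "g 3"]) (simp_all add: inj_on_def)
qed

lemma isomorphic_G5I:
  assumes "distinct [a, b, c]"
  shows "graph_isomorphic (edge_graph {{a, b}, {b, c}, {a, c}}) G5"
  unfolding edge_graph_G using assms
  by (intro graph_isomorphic_listI[of "[a, b, c]"]) (auto simp: lessThan_nat_numeral lessThan_Suc)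

lemma isomorphic_G5E:
  assumes "graph_isomorphic (edge_graph E) G5" "\<forall>e\<in>E. \<exists>u v. e = {u, v}"
  obtains a b c where "distinct [a, b, c]" "E = {{a, b}, {b, c}, {a, c}}"
proof -
  obtain g where "inj_on g (\<Union>{{0::nat, 1}, {1, 2}, {0, 2}})" "E = (`) g ` {{0::nat, 1}, {1, 2}, {0, 2}}"
    using assms unfolding edge_graph_G by (rule graph_isomorphic_edge_imageE) auto
  then show thesis
    by (intro that[of "g 0" "g 1" "g 2"]) (simp_all add: inj_on_def)
qed

lemma isomorphic_card_vertices:
  "graph_isomorphic G H \<Longrightarrow> card (fst G) = card (fst H)"
  unfolding graph_isomorphic_def using bij_betw_same_card by blast

text \<open>Vertex counts tell all types apart except \<open>G3\<close> and \<open>G4\<close>, which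
  \<open>not_isomorphic_G3_G4\<close> separates.\<close>

lemma card_vertices_G:
  "card (fst G1) = 6" "card (fst G2) = 5" "card (fst G3) = 4" "card (fst G4) = 4" "card (fst G5) = 3"
  by (auto simp: G1_def G2_def G3_def G4_def G5_def)

section \<open>Classification of three distinct edges\<close>

lemma card_2_memE:
  assumes "card A = 2" "x \<in> A"
  obtains y where "A = {x, y}" "x \<noteq> y"
  using assms unfolding card_2_iff by (metis insertE insert_commute singletonD)

text \<open>\<open>A\<close> and \<open>B\<close> form a path \<open>x\<close>, \<open>y\<close>,
  \<open>z\<close>. If both ends of \<open>D\<close> lie on it, \<open>D\<close> closes a triangle;
  otherwise the position of the other end decides.\<close>

lemma intersecting_edges_cases:
  assumes "card A = 2" "card B = 2" "card D = 2" "A \<noteq> B" "A \<noteq> D" "B \<noteq> D" "A \<inter> B \<noteq> {}"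
  shows "\<exists>G\<in>{G2, G3, G4, G5}. graph_isomorphic (edge_graph {A, B, D}) G"
proof -
  obtain y where y: "y \<in> A" "y \<in> B" using assms by blast
  obtain x where x: "A = {x, y}" "x \<noteq> y" using y assms(1) by (auto simp: card_2_iff)
  obtain z where z: "B = {y, z}" "z \<noteq> y" using y assms(2) by (auto simp: card_2_iff)
  have "x \<noteq> z" using assms(4) x z by auto
  obtain e f where ef: "D = {e, f}" "e \<noteq> f" using assms(3) by (auto simp: card_2_iff)
  \<comment> \<open>Here \<open>v\<close> is an end of \<open>D\<close> off the path. The other end
    \<open>u\<close> gives \<open>G2\<close> when it is off the path too, \<open>G4\<close> at the
    middle, and \<open>G3\<close> at either end of the path. Both orders of the ends of
    \<open>D\<close> are used below.\<close>
  have one: ?thesis if D: "D = {u, v}" "u \<noteq> v" "v \<notin> {x, y, z}" for u v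
  proof -
    consider "u \<notin> {x, y, z}" | "u = x" | "u = y" | "u = z" by blast
    then show ?thesis
    proof cases
      case 1
      then have "graph_isomorphic (edge_graph {A, B, D}) G2"
        using D x z \<open>x \<noteq> z\<close> isomorphic_G2I[of x y z u v] by auto
      then show ?thesis by blast
    next
      case 2
      then have "graph_isomorphic (edge_graph {A, B, D}) G3"
        using D x z \<open>x \<noteq> z\<close> isomorphic_G3I[of z y x v] by (auto simp: insert_commute)
      then show ?thesis by blast
    next
      case 3
      then have "graph_isomorphic (edge_graph {A, B, D}) G4"
        using D x z \<open>x \<noteq> z\<close> isomorphic_G4I[of y x z v] by (auto simp: insert_commute)
      then show ?thesis by blast
    next
      case 4
      then have "graph_isomorphic (edge_graph {A, B, D}) G3"
        using D x z \<open>x \<noteq> z\<close> isomorphic_G3I[of x y z v] by (auto simp: insert_commute)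
      then show ?thesis by blast
    qed
  qed
  show ?thesis
  proof (cases "e \<in> {x, y, z} \<and> f \<in> {x, y, z}")
    case True
    then have "D = {x, z}" using ef x z assms(5,6) by auto
    then have "graph_isomorphic (edge_graph {A, B, D}) G5"
      using x z \<open>x \<noteq> z\<close> isomorphic_G5I[of x y z] by auto
    then show ?thesis by blast
  next
    case False
    then consider "e \<notin> {x, y, z}" | "f \<notin> {x, y, z}" by blast
    then show ?thesis using one[of e f] one[of f e] ef by cases blast+
  qed
qed

lemma three_edges_cases:
  assumes "card A = 2" "card B = 2" "card D = 2" "A \<noteq> B" "A \<noteq> D" "B \<noteq> D"
  shows "\<exists>G\<in>{G1, G2, G3, G4, G5}. graph_isomorphic (edge_graph {A, B, D}) G"
proof (cases "A \<inter> B = {} \<and> A \<inter> D = {} \<and> B \<inter> D = {}")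
  case True
  obtain a b c d e f where "A = {a, b}" "a \<noteq> b" "B = {c, d}" "c \<noteq> d" "D = {e, f}" "e \<noteq> f"
    using assms(1-3) by (auto simp: card_2_iff)
  then have "graph_isomorphic (edge_graph {A, B, D}) G1"
    using True isomorphic_G1I[of a b c d e f] by auto
  then show ?thesis by blast
next
  case False
  \<comment> \<open>The edge set is unordered, so any two edges that meet may play the part of the
    first two.\<close>
  moreover have "{A, D, B} = {A, B, D}" "{B, D, A} = {A, B, D}" by auto
  ultimately show ?thesis
    using intersecting_edges_cases[OF assms] intersecting_edges_cases[of A D B]
      intersecting_edges_cases[of B D A] assms by (auto simp: Int_commute)
qed

section \<open>Two vertices meeting all edges\<close>

text \<open>These are the vertex covers of size two of the graph \<open>(C, E)\<close>. For an
  \<open>(n + 1)\<close>-cover \<open>C\<close> and its edges they will be the complements in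
  \<open>C\<close> of the partial transversals of deficit 1.\<close>

definition pair_covers :: "'v set \<Rightarrow> 'v set set \<Rightarrow> 'v set set" where
  "pair_covers C E = {W. W \<subseteq> C \<and> card W = 2 \<and> (\<forall>A\<in>E. W \<inter> A \<noteq> {})}"

lemma pair_covers_iff:
  "W \<in> pair_covers C E \<longleftrightarrow>
    (\<exists>x\<in>C. \<exists>y\<in>C. x \<noteq> y \<and> W = {x, y} \<and> (\<forall>A\<in>E. x \<in> A \<or> y \<in> A))"
  by (auto simp: pair_covers_def card_2_iff)

text \<open>Three disjoint edges need three vertices.\<close>

lemma pair_covers_G1:
  assumes "graph_isomorphic (edge_graph E) G1" "\<forall>e\<in>E. \<exists>u v. e = {u, v}"
  shows "pair_covers C E = {}"
proof -
  obtain a b c d e f where "distinct [a, b, c, d, e, f]" "E = {{a, b}, {c, d}, {e, f}}"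
    using assms(1,2) by (rule isomorphic_G1E)
  then show ?thesis by (auto simp: set_eq_iff[of "pair_covers C E"] pair_covers_iff)
qed

text \<open>The isolated edge takes one vertex, and the only vertex on both remaining edges is the
  middle \<open>b\<close> of the path.\<close>

lemma pair_covers_G2:
  assumes "graph_isomorphic (edge_graph E) G2" "\<forall>e\<in>E. \<exists>u v. e = {u, v}" "\<Union>E \<subseteq> C"
  shows "card (pair_covers C E) = 2"
proof -
  obtain a b c d e where abc: "distinct [a, b, c, d, e]" "E = {{a, b}, {b, c}, {d, e}}"
    using assms(1,2) by (rule isomorphic_G2E)
  then have "W \<in> pair_covers C E \<longleftrightarrow> W \<in> {{b, d}, {b, e}}" for W
    unfolding pair_covers_iff using abc(1) assms(3) unfolding abc(2)
    by (auto simp: doubleton_eq_iff)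
  then have "pair_covers C E = {{b, d}, {b, e}}" by (rule set_eqI)
  then show ?thesis using abc(1) by (auto simp: card_insert_if doubleton_eq_iff)
qed

text \<open>The end edges are disjoint, so each takes one vertex; of the four choices only
  \<open>{a, d}\<close> misses the middle edge.\<close>

lemma pair_covers_G3:
  assumes "graph_isomorphic (edge_graph E) G3" "\<forall>e\<in>E. \<exists>u v. e = {u, v}" "\<Union>E \<subseteq> C"
  shows "card (pair_covers C E) = 3"
proof -
  obtain a b c d where abc: "distinct [a, b, c, d]" "E = {{a, b}, {b, c}, {c, d}}"
    using assms(1,2) by (rule isomorphic_G3E)
  then have "W \<in> pair_covers C E \<longleftrightarrow> W \<in> {{b, c}, {a, c}, {b, d}}" for W
    unfolding pair_covers_iff using abc(1) assms(3) unfolding abc(2)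
    by (auto simp: doubleton_eq_iff)
  then have "pair_covers C E = {{b, c}, {a, c}, {b, d}}" by (rule set_eqI)
  then show ?thesis using abc(1) by (auto simp: card_insert_if doubleton_eq_iff)
qed

text \<open>Each vertex of a triangle misses just the opposite edge, so any two of the three
  vertices suffice, while a vertex off the triangle is of no help.\<close>

lemma pair_covers_G5:
  assumes "graph_isomorphic (edge_graph E) G5" "\<forall>e\<in>E. \<exists>u v. e = {u, v}" "\<Union>E \<subseteq> C"
  shows "card (pair_covers C E) = 3"
proof -
  obtain a b c where abc: "distinct [a, b, c]" "E = {{a, b}, {b, c}, {a, c}}"
    using assms(1,2) by (rule isomorphic_G5E)
  then have "W \<in> pair_covers C E \<longleftrightarrow> W \<in> {{a, b}, {b, c}, {a, c}}" for W
    unfolding pair_covers_iff using abc(1) assms(3) unfolding abc(2)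
    by (auto simp: doubleton_eq_iff)
  then have "pair_covers C E = {{a, b}, {b, c}, {a, c}}" by (rule set_eqI)
  then show ?thesis using abc(1) by (auto simp: card_insert_if doubleton_eq_iff)
qed

text \<open>Distinct edges through a common vertex have distinct other ends and hence form a star.
  This will identify redundant entries.\<close>

lemma common_vertex_iff_G4:
  assumes "card A = 2" "card B = 2" "card D = 2" "A \<noteq> B" "A \<noteq> D" "B \<noteq> D"
  shows "A \<inter> B \<inter> D \<noteq> {} \<longleftrightarrow> graph_isomorphic (edge_graph {A, B, D}) G4"
proof -
  have pairs: "\<forall>e\<in>{A, B, D}. \<exists>u v. e = {u, v}"
    using assms(1-3) by (auto simp: card_2_iff)
  show ?thesis
  proof
    assume "A \<inter> B \<inter> D \<noteq> {}"
    then obtain x where x: "x \<in> A" "x \<in> B" "x \<in> D" by blast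
    obtain a where "A = {x, a}" "x \<noteq> a" using assms(1) x(1) by (rule card_2_memE)
    moreover obtain b where "B = {x, b}" "x \<noteq> b" using assms(2) x(2) by (rule card_2_memE)
    moreover obtain d where "D = {x, d}" "x \<noteq> d" using assms(3) x(3) by (rule card_2_memE)
    ultimately show "graph_isomorphic (edge_graph {A, B, D}) G4"
      using assms isomorphic_G4I[of x a b d] by auto
  next
    assume "graph_isomorphic (edge_graph {A, B, D}) G4"
    then obtain a b c d where abcd: "{A, B, D} = {{a, b}, {a, c}, {a, d}}"
      using pairs by (rule isomorphic_G4E)
    have "\<forall>X\<in>{A, B, D}. a \<in> X" unfolding abcd by simp
    then show "A \<inter> B \<inter> D \<noteq> {}" by auto
  qed
qed

text \<open>A star has a vertex on all its edges, whereas the end edges of a path with three edges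
  are disjoint.\<close>

lemma not_isomorphic_G3_G4:
  assumes "graph_isomorphic (edge_graph E) G3" "\<forall>e\<in>E. \<exists>u v. e = {u, v}"
  shows "\<not> graph_isomorphic (edge_graph E) G4"
proof
  assume G4: "graph_isomorphic (edge_graph E) G4"
  obtain a b c d where abcd: "distinct [a, b, c, d]" "E = {{a, b}, {b, c}, {c, d}}"
    using assms by (rule isomorphic_G3E)
  obtain w x y z where wxyz: "distinct [w, x, y, z]" "E = {{w, x}, {w, y}, {w, z}}"
    using G4 assms(2) by (rule isomorphic_G4E)
  have "\<forall>e\<in>E. w \<in> e" unfolding wxyz by simp
  then show False unfolding abcd(2) using abcd(1) by auto
qed

section \<open>Covers and partial transversals in orthogonal arrays\<close>

datatype axis = Row | Col | Symb

lemma UNIV_axis: "UNIV = {Row, Col, Symb}"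
  using axis.exhaust by blast

lemma all_axis: "(\<forall>k. Q k) \<longleftrightarrow> Q Row \<and> Q Col \<and> Q Symb"
  by (metis axis.exhaust)

lemma ex_axis: "(\<exists>k. Q k) \<longleftrightarrow> Q Row \<or> Q Col \<or> Q Symb"
  by (metis axis.exhaust)

lemma third_axis:
  assumes "(k::axis) \<noteq> l"
  obtains j where "j \<noteq> k" "j \<noteq> l" "UNIV = {k, l, j}"
  using assms unfolding UNIV_axis by (cases k; cases l) auto

lemma other_axes:
  obtains l j where "l \<noteq> k" "j \<noteq> k" "j \<noteq> l" "UNIV = {k :: axis, l, j}"
proof -
  obtain l where "k \<noteq> (l :: axis)" by (metis axis.distinct(1))
  then show thesis using that third_axis by metis
qed

text \<open>Passing from the \<open>(row, column, symbol)\<close> triples to three interchangeable coordinates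
  makes the conjugate arguments literally the same argument.\<close>

locale orthogonal_array =
  fixes n :: nat and E :: "'e set" and coord :: "axis \<Rightarrow> 'e \<Rightarrow> 'v" and vals :: "axis \<Rightarrow> 'v set"
  assumes n_pos: "0 < n"
    and card_vals: "card (vals k) = n"
    and coord_vals: "e \<in> E \<Longrightarrow> coord k e \<in> vals k"
    and ex1_entry: "\<lbrakk>k \<noteq> l; x \<in> vals k; y \<in> vals l\<rbrakk> \<Longrightarrow> \<exists>!e. e \<in> E \<and> coord k e = x \<and> coord l e = y"
begin

lemma finite_vals: "finite (vals k)"
  using card_vals[of k] n_pos card_ge_0_finite by metis

lemma coord_eqI:
  "\<lbrakk>e \<in> E; f \<in> E; k \<noteq> l; coord k e = coord k f; coord l e = coord l f\<rbrakk> \<Longrightarrow> e = f"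
  using ex1_entry[of k l "coord k e" "coord l e"] coord_vals by metis

lemma card_line:
  assumes "x \<in> vals k"
  shows "card {e \<in> E. coord k e = x} = n"
proof -
  obtain l where "k \<noteq> l" by (metis axis.distinct(1))
  then have "bij_betw (coord l) {e \<in> E. coord k e = x} (vals l)"
    unfolding bij_betw_def inj_on_def
    using coord_eqI coord_vals ex1_entry[OF \<open>k \<noteq> l\<close> assms] by (auto simp: image_iff) metis+
  then show ?thesis using card_vals bij_betw_same_card by metis
qed

lemma card_entries: "card E = n * n"
proof -
  have "bij_betw (\<lambda>e. (coord Row e, coord Col e)) E (vals Row \<times> vals Col)"
    unfolding bij_betw_def
  proof
    show "inj_on (\<lambda>e. (coord Row e, coord Col e)) E"
      by (rule inj_onI) (use coord_eqI[of _ _ Row Col] in auto)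
    have "(x, y) \<in> (\<lambda>e. (coord Row e, coord Col e)) ` E" if "x \<in> vals Row" "y \<in> vals Col" for x y
      using ex1_entry[of Row Col x y] that by auto
    then show "(\<lambda>e. (coord Row e, coord Col e)) ` E = vals Row \<times> vals Col"
      using coord_vals by auto
  qed
  then have "card E = card (vals Row \<times> vals Col)" by (rule bij_betw_same_card)
  then show ?thesis by (simp add: card_cartesian_product card_vals)
qed

lemma finite_entries: "finite E"
  using card_entries n_pos card_ge_0_finite by (metis nat_0_less_mult_iff)

section \<open>Covers and separated sets\<close>

definition is_cover :: "'e set \<Rightarrow> bool" where
  "is_cover C \<longleftrightarrow> C \<subseteq> E \<and> (\<forall>k. coord k ` C = vals k)"

text \<open>This is a partial transversal without a prescribed size, as maximality has to speak of
  sets with one more entry.\<close>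

definition separated :: "'e set \<Rightarrow> bool" where
  "separated P \<longleftrightarrow> P \<subseteq> E \<and> (\<forall>k. inj_on (coord k) P)"

definition covers :: "'e set set" where
  "covers = {C. is_cover C \<and> card C = n + 1}"

definition min_covers :: "'e set set" where
  "min_covers = {C \<in> covers. \<forall>e\<in>C. \<not> is_cover (C - {e})}"

definition transversals :: "'e set set" where
  "transversals = {T. separated T \<and> card T = n}"

definition near_transversals :: "'e set set" where
  "near_transversals = {P. separated P \<and> card P + 1 = n}"

definition max_near_transversals :: "'e set set" where
  "max_near_transversals = {P \<in> near_transversals. \<forall>e\<in>E - P. \<not> separated (insert e P)}"

text \<open>In an \<open>(n + 1)\<close>-cover this is the unique edge joining two entries that agree on axis \<open>k\<close>.\<close>

definition repeated :: "'e set \<Rightarrow> axis \<Rightarrow> 'e set" where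
  "repeated C k = {e \<in> C. \<exists>f\<in>C - {e}. coord k f = coord k e}"

abbreviation edges :: "'e set \<Rightarrow> 'e set set" where
  "edges C \<equiv> range (repeated C)"

definition typed_covers :: "nat ugraph \<Rightarrow> 'e set set" where
  "typed_covers G = {C \<in> covers. graph_isomorphic (edge_graph (edges C)) G}"

lemma finite_covers: "finite covers"
  by (rule finite_subset[of _ "Pow E"]) (auto simp: covers_def is_cover_def finite_entries)

lemma finite_separated: "finite {P. separated P}"
  by (rule finite_subset[of _ "Pow E"]) (auto simp: separated_def finite_entries)

lemma coversD:
  assumes "C \<in> covers"
  shows "C \<subseteq> E" "coord k ` C = vals k" "card C = n + 1" "finite C"
  using assms finite_entries finite_subset by (auto simp: covers_def is_cover_def)

lemma separated_subset: "separated P \<Longrightarrow> Q \<subseteq> P \<Longrightarrow> separated Q"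
  unfolding separated_def by (meson inj_on_subset order_trans)

text \<open>Between sets of the same finite size \<open>n\<close>, injective and surjective
  coincide. Transversals are thus the covers of size \<open>n\<close>.\<close>

lemma separated_card_n_iff_is_cover:
  assumes "card T = n"
  shows "separated T \<longleftrightarrow> is_cover T"
proof -
  have "finite T" using assms n_pos card_ge_0_finite by metis
  have "inj_on (coord k) T \<longleftrightarrow> coord k ` T = vals k" if "T \<subseteq> E" for k
  proof
    assume "inj_on (coord k) T"
    then have "card (coord k ` T) = card (vals k)" using assms by (simp add: card_image card_vals)
    moreover have "coord k ` T \<subseteq> vals k" using that coord_vals by blast
    ultimately show "coord k ` T = vals k" using finite_vals by (simp add: card_subset_eq)
  next
    assume "coord k ` T = vals k"
    then show "inj_on (coord k) T"
      using \<open>finite T\<close> assms card_vals by (intro eq_card_imp_inj_on) simp_all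
  qed
  then show ?thesis unfolding separated_def is_cover_def by blast
qed

section \<open>The repeated values of a cover\<close>

lemma repeated_eq:
  assumes C: "C \<in> covers" and ab: "a \<in> C" "b \<in> C" "a \<noteq> b" "coord k a = coord k b"
  shows "repeated C k = {a, b}" "inj_on (coord k) (C - {a})"
proof -
  \<comment> \<open>The value of \<open>x\<close> survives at \<open>y\<close>, so the remaining
    \<open>n\<close> entries still take all \<open>n\<close> values and no further repetition is
    possible.\<close>
  have inj: "inj_on (coord k) (C - {x})" if "x \<in> C" "y \<in> C" "x \<noteq> y" "coord k x = coord k y" for x y
  proof (rule eq_card_imp_inj_on)
    have "coord k x \<in> coord k ` (C - {x})" using that by (metis DiffI imageI singletonD)
    then have "coord k ` (C - {x}) = coord k ` insert x (C - {x})" by blast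
    then have "coord k ` (C - {x}) = coord k ` C" using that by (simp add: insert_absorb)
    then show "card (coord k ` (C - {x})) = card (C - {x})"
      using coversD[OF C] that by (simp add: card_vals)
  qed (use coversD[OF C] in simp)
  show "inj_on (coord k) (C - {a})" using inj ab by blast
  show "repeated C k = {a, b}"
  proof
    show "{a, b} \<subseteq> repeated C k" using ab by (auto simp: repeated_def)
    show "repeated C k \<subseteq> {a, b}"
    proof
      fix e assume "e \<in> repeated C k"
      then obtain f where f: "e \<in> C" "f \<in> C" "f \<noteq> e" "coord k f = coord k e"
        by (auto simp: repeated_def)
      \<comment> \<open>If \<open>x\<close> were neither \<open>e\<close> nor \<open>f\<close>, both
        would survive its removal and contradict injectivity. Hence \<open>a\<close> and
        \<open>b\<close> both lie in \<open>{e, f}\<close>.\<close>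
      have "\<not> (x \<noteq> e \<and> x \<noteq> f)" if "x \<in> {a, b}" for x
        using inj[of a b] inj[of b a] ab f that inj_onD[of "coord k" "C - {x}" f e] by auto
      then show "e \<in> {a, b}" using ab(3) by blast
    qed
  qed
qed

text \<open>Pigeonhole: \<open>n + 1\<close> entries share \<open>n\<close> values.\<close>

lemma repeated_pair:
  assumes C: "C \<in> covers"
  obtains a b where "a \<in> C" "b \<in> C" "a \<noteq> b" "coord k a = coord k b" "repeated C k = {a, b}"
proof -
  have "\<not> inj_on (coord k) C"
  proof
    assume "inj_on (coord k) C"
    then have "card (coord k ` C) = n + 1" using coversD(3)[OF C] by (simp add: card_image)
    then show False using coversD(2)[OF C] card_vals by simp
  qed
  then obtain a b where ab: "a \<in> C" "b \<in> C" "a \<noteq> b" "coord k a = coord k b"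
    by (auto simp: inj_on_def)
  show thesis by (rule that[OF ab repeated_eq(1)[OF C ab]])
qed

lemma card_repeated: "C \<in> covers \<Longrightarrow> card (repeated C k) = 2"
  by (rule repeated_pair[of C k]) auto

lemma edges_doubletons:
  assumes C: "C \<in> covers"
  shows "\<forall>e\<in>edges C. \<exists>u v. e = {u, v}"
proof
  fix e assume "e \<in> edges C"
  then obtain k where "e = repeated C k" by blast
  then show "\<exists>u v. e = {u, v}" using repeated_pair[OF C, of k] by metis
qed

lemma edges_subset: "\<Union> (edges C) \<subseteq> C"
  by (auto simp: repeated_def)

text \<open>Otherwise two different entries would agree on two axes.\<close>

lemma repeated_neq:
  assumes C: "C \<in> covers" and "k \<noteq> l"
  shows "repeated C k \<noteq> repeated C l"
proof
  assume eq: "repeated C k = repeated C l"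
  obtain a b where a: "a \<in> C" "b \<in> C" "a \<noteq> b" "coord k a = coord k b" "repeated C k = {a, b}"
    by (rule repeated_pair[OF C])
  obtain c d where c: "coord l c = coord l d" "repeated C l = {c, d}"
    by (rule repeated_pair[OF C])
  have "coord l a = coord l b" using a c eq by (auto simp: doubleton_eq_iff)
  then have "a = b" using a \<open>k \<noteq> l\<close> coversD[OF C] by (intro coord_eqI[of a b k l]) auto
  then show False using a by simp
qed

lemma edges_eq: "edges C = {repeated C Row, repeated C Col, repeated C Symb}"
  unfolding UNIV_axis by simp

section \<open>Types of covers and minimality\<close>

lemma typed_covers_cases:
  assumes "C \<in> covers"
  shows "\<exists>G\<in>{G1, G2, G3, G4, G5}. C \<in> typed_covers G"
  using three_edges_cases[of "repeated C Row" "repeated C Col" "repeated C Symb"]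
    card_repeated[OF assms] repeated_neq[OF assms] assms
  unfolding typed_covers_def edges_eq by simp

lemma typed_covers_disjoint:
  assumes "card (fst G) \<noteq> card (fst H)"
  shows "typed_covers G \<inter> typed_covers H = {}"
proof -
  have "card (fst G) = card (fst H)" if "C \<in> typed_covers G" "C \<in> typed_covers H" for C
    using that isomorphic_card_vertices[of "edge_graph (edges C)" G]
      isomorphic_card_vertices[of "edge_graph (edges C)" H] by (simp add: typed_covers_def)
  then show ?thesis using assms by blast
qed

lemma typed_covers_G3_G4: "typed_covers G3 \<inter> typed_covers G4 = {}"
  using not_isomorphic_G3_G4 edges_doubletons unfolding typed_covers_def by blast

text \<open>Removing \<open>e\<close> can only lose the values of \<open>e\<close>, and each
  survives exactly when another entry carries it.\<close>

lemma is_cover_remove_iff: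
  assumes C: "C \<in> covers" and "e \<in> C"
  shows "is_cover (C - {e}) \<longleftrightarrow> (\<forall>k. e \<in> repeated C k)"
proof -
  have "coord k ` (C - {e}) = vals k \<longleftrightarrow> e \<in> repeated C k" for k
  proof -
    have "vals k = insert (coord k e) (coord k ` (C - {e}))"
      using coversD(2)[OF C, of k] \<open>e \<in> C\<close> by blast
    then have "coord k ` (C - {e}) = vals k \<longleftrightarrow> coord k e \<in> coord k ` (C - {e})"
      by (metis insert_absorb insertI1)
    also have "\<dots> \<longleftrightarrow> (\<exists>f\<in>C - {e}. coord k f = coord k e)" unfolding image_iff by metis
    also have "\<dots> \<longleftrightarrow> e \<in> repeated C k" using \<open>e \<in> C\<close> by (simp add: repeated_def)
    finally show ?thesis .
  qed
  then show ?thesis using coversD(1)[OF C] by (auto simp: is_cover_def)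
qed

text \<open>A redundant entry is a vertex common to all three edges, that is, the centre of a
  star.\<close>

lemma min_covers_iff:
  assumes "C \<in> covers"
  shows "C \<in> min_covers \<longleftrightarrow> C \<notin> typed_covers G4"
proof -
  have "C \<in> min_covers \<longleftrightarrow> \<not> (\<exists>e\<in>C. \<forall>k. e \<in> repeated C k)"
    using assms is_cover_remove_iff[OF assms] by (auto simp: min_covers_def)
  also have "(\<exists>e\<in>C. \<forall>k. e \<in> repeated C k) \<longleftrightarrow>
      repeated C Row \<inter> repeated C Col \<inter> repeated C Symb \<noteq> {}"
  proof -
    have "repeated C Row \<subseteq> C" by (auto simp: repeated_def)
    then show ?thesis unfolding all_axis by blast
  qed
  also have "\<dots> \<longleftrightarrow> C \<in> typed_covers G4"
    using common_vertex_iff_G4[of "repeated C Row" "repeated C Col" "repeated C Symb"]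
      card_repeated[OF assms] repeated_neq[OF assms] assms
    unfolding typed_covers_def edges_eq by simp
  finally show ?thesis .
qed

lemma min_covers_eq:
  "min_covers = typed_covers G1 \<union> typed_covers G2 \<union> typed_covers G3 \<union> typed_covers G5"
proof -
  have "typed_covers G1 \<inter> typed_covers G4 = {}" "typed_covers G2 \<inter> typed_covers G4 = {}"
    "typed_covers G5 \<inter> typed_covers G4 = {}"
    using typed_covers_disjoint card_vertices_G by simp_all
  moreover have "min_covers \<subseteq> covers" "typed_covers G \<subseteq> covers" for G
    by (auto simp: min_covers_def typed_covers_def)
  ultimately show ?thesis
    using min_covers_iff typed_covers_cases typed_covers_G3_G4 by blast
qed

lemma finite_typed_covers: "finite (typed_covers G)"
  using finite_covers by (simp add: typed_covers_def)

lemma card_G3_G5: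
  "card (typed_covers G3 \<union> typed_covers G5) = card (typed_covers G3) + card (typed_covers G5)"
  by (simp add: card_Un_disjoint finite_typed_covers typed_covers_disjoint card_vertices_G)

lemma card_min_covers:
  "card min_covers = card (typed_covers G1) + card (typed_covers G2)
     + card (typed_covers G3) + card (typed_covers G5)"
proof -
  have "(typed_covers G1 \<union> typed_covers G2) \<inter> typed_covers G3 = {}"
    "(typed_covers G1 \<union> typed_covers G2 \<union> typed_covers G3) \<inter> typed_covers G5 = {}"
    by (simp_all add: Int_Un_distrib2 typed_covers_disjoint card_vertices_G)
  then show ?thesis
    unfolding min_covers_eq
    by (simp add: card_Un_disjoint finite_typed_covers typed_covers_disjoint card_vertices_G)
qed

section \<open>Partial transversals of deficit 1 inside a cover\<close>

text \<open>The only repetition on axis \<open>k\<close> is the edge \<open>repeated C k\<close>, so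
  \<open>P\<close> is injective there exactly when it omits an end of that edge. The sizes match
  because \<open>(n + 1) - 2 = n - 1\<close>.\<close>

lemma near_transversal_iff_pair_cover:
  assumes C: "C \<in> covers" and "P \<subseteq> C"
  shows "P \<in> near_transversals \<longleftrightarrow> C - P \<in> pair_covers C (edges C)"
proof -
  have "inj_on (coord k) P \<longleftrightarrow> (C - P) \<inter> repeated C k \<noteq> {}" for k
  proof -
    obtain a b where ab: "a \<in> C" "b \<in> C" "a \<noteq> b" "coord k a = coord k b" "repeated C k = {a, b}"
      by (rule repeated_pair[OF C])
    have "inj_on (coord k) P" if "a \<notin> P"
      using repeated_eq(2)[OF C ab(1-4)] by (rule inj_on_subset) (use that \<open>P \<subseteq> C\<close> in auto)
    moreover have "inj_on (coord k) P" if "b \<notin> P"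
      using repeated_eq(2)[OF C ab(2,1) ab(3,4)[symmetric]]
      by (rule inj_on_subset) (use that \<open>P \<subseteq> C\<close> in auto)
    moreover have "\<not> inj_on (coord k) P" if "a \<in> P" "b \<in> P"
      using that ab by (auto simp: inj_on_def)
    ultimately show ?thesis using ab by auto
  qed
  moreover have "card P + 1 = n \<longleftrightarrow> card (C - P) = 2"
    using coversD(3,4)[OF C] \<open>P \<subseteq> C\<close> card_mono[of C P] by (subst card_Diff_subset) (auto intro: finite_subset)
  ultimately show ?thesis
    using \<open>P \<subseteq> C\<close> coversD(1)[OF C] by (auto simp: near_transversals_def separated_def pair_covers_def)
qed

lemma card_near_transversals_in_cover:
  assumes C: "C \<in> covers"
  shows "card {P \<in> near_transversals. P \<subseteq> C} = card (pair_covers C (edges C))"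
proof (rule bij_betw_same_card[of "\<lambda>P. C - P"])
  show "bij_betw (\<lambda>P. C - P) {P \<in> near_transversals. P \<subseteq> C} (pair_covers C (edges C))"
    unfolding bij_betw_def
  proof
    show "inj_on (\<lambda>P. C - P) {P \<in> near_transversals. P \<subseteq> C}" by (rule inj_onI) blast
    have "W \<in> (\<lambda>P. C - P) ` {P \<in> near_transversals. P \<subseteq> C}" if "W \<in> pair_covers C (edges C)" for W
    proof -
      have "W = C - (C - W)" using that by (auto simp: pair_covers_def)
      then show ?thesis using near_transversal_iff_pair_cover[OF C, of "C - W"] that by auto
    qed
    then show "(\<lambda>P. C - P) ` {P \<in> near_transversals. P \<subseteq> C} = pair_covers C (edges C)"
      using near_transversal_iff_pair_cover[OF C] by blast
  qed
qed

text \<open>If \<open>P\<close> extended to a transversal by \<open>e\<close>, then either \<open>e \<in> C\<close>, which makes an entry of \<open>C\<close>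
  redundant, or the two entries of \<open>C - P\<close> share the three coordinates of \<open>e\<close>, so one of them
  takes two and equals \<open>e\<close>.\<close>

lemma near_transversal_in_min_cover:
  assumes "C \<in> min_covers" "P \<in> near_transversals" "P \<subseteq> C"
  shows "P \<in> max_near_transversals"
proof (rule ccontr)
  assume "P \<notin> max_near_transversals"
  then obtain e where e: "e \<in> E" "e \<notin> P" "separated (insert e P)"
    using assms(2) by (auto simp: max_near_transversals_def)
  have C: "C \<in> covers" using assms(1) by (simp add: min_covers_def)
  note CD = coversD[OF C]
  have P: "card P + 1 = n" "P \<subseteq> E" using assms(2) by (auto simp: near_transversals_def separated_def)
  have "finite P" using assms(3) CD finite_subset by blast
  then have "card (insert e P) = n" using P e by simp
  then have cov: "is_cover (insert e P)" using e separated_card_n_iff_is_cover by blast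
  have "card (C - P) = 2" using CD P \<open>finite P\<close> assms(3) by (simp add: card_Diff_subset)
  then obtain f g where fg: "C - P = {f, g}" "f \<noteq> g" by (auto simp: card_2_iff)
  show False
  proof (cases "e \<in> C")
    case True
    obtain h where "C - P = {e, h}" "e \<noteq> h"
      by (rule card_2_memE[OF \<open>card (C - P) = 2\<close>]) (use True e in blast)
    then have "C - {h} = insert e P" "h \<in> C" using assms(3) by auto
    then show False using cov assms(1) by (auto simp: min_covers_def)
  next
    case False
    have "coord k f = coord k e \<or> coord k g = coord k e" for k
    proof -
      have "coord k e \<in> coord k ` C" using CD(2) coord_vals e by blast
      moreover have "coord k e \<notin> coord k ` P"
        using e by (auto simp: separated_def inj_on_def)
      ultimately show ?thesis using fg by force
    qed
    then have "\<exists>k l x. k \<noteq> l \<and> x \<in> {f, g} \<and> coord k x = coord k e \<and> coord l x = coord l e"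
      by (metis axis.distinct(1,3,5) insertCI)
    then obtain k l x where x: "k \<noteq> l" "x \<in> {f, g}" "coord k x = coord k e" "coord l x = coord l e"
      by blast
    then have "x \<in> C" using fg by blast
    then have "x = e" using coord_eqI[of x e k l] x CD(1) e(1) by blast
    then show False using False \<open>x \<in> C\<close> by blast
  qed
qed

text \<open>A redundant entry \<open>h\<close> lies on three edges, so two deleted entries hit all edges only if \<open>h\<close> is
  one of them; the partial transversal is then a subset of the transversal \<open>C - {h}\<close>.\<close>

lemma near_transversal_in_nonmin_cover:
  assumes C: "C \<in> covers" "C \<notin> min_covers" and P: "P \<in> near_transversals" "P \<subseteq> C"
  shows "P \<notin> max_near_transversals"
proof -
  obtain h where h: "h \<in> C" "is_cover (C - {h})"
    using C by (auto simp: min_covers_def)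
  note CD = coversD[OF C(1)]
  have h_rep: "h \<in> repeated C k" for k using is_cover_remove_iff[OF C(1) h(1)] h(2) by blast
  have T: "separated (C - {h})" "card (C - {h}) = n"
    using h CD separated_card_n_iff_is_cover[of "C - {h}"] by auto
  have cP: "card P + 1 = n" "separated P" using P by (auto simp: near_transversals_def)
  have "h \<notin> P"
  proof
    assume "h \<in> P"
    \<comment> \<open>If \<open>h\<close> stays in \<open>P\<close>, its partner on each axis must
      be omitted. The three partners differ because the edges do, but only two entries are
      omitted.\<close>
    have "\<exists>y. repeated C k = {h, y} \<and> y \<in> C - P" for k
    proof -
      obtain y where y: "repeated C k = {h, y}" "h \<noteq> y"
        by (rule card_2_memE[OF card_repeated[OF C(1)] h_rep])
      obtain a b where "coord k a = coord k b" "repeated C k = {a, b}"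
        by (rule repeated_pair[OF C(1)])
      then have "coord k h = coord k y" using y by (auto simp: doubleton_eq_iff)
      then have "y \<notin> P" using \<open>h \<in> P\<close> cP(2) y by (auto simp: separated_def inj_on_def)
      then show ?thesis using y by (auto simp: repeated_def)
    qed
    then obtain y where y: "\<And>k. repeated C k = {h, y k}" "\<And>k. y k \<in> C - P" by metis
    have "inj y" using repeated_neq[OF C(1)] y(1) by (metis injI)
    then have "card (range y) = 3" by (simp add: card_image UNIV_axis)
    moreover have "card (C - P) = 2"
      using CD P(2) cP by (simp add: card_Diff_subset finite_subset)
    ultimately show False using card_mono[of "C - P" "range y"] y(2) CD(4) by auto
  qed
  then have sub: "P \<subseteq> C - {h}" using P by blast
  moreover have "P \<noteq> C - {h}" using T cP by auto
  ultimately obtain x where x: "x \<in> C - {h}" "x \<notin> P" by blast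
  have "insert x P \<subseteq> C - {h}" using x sub by blast
  then have "separated (insert x P)" by (rule separated_subset[OF T(1)])
  then show ?thesis using x CD(1) by (auto simp: max_near_transversals_def)
qed

lemma max_near_transversals_in_min_cover:
  "C \<in> min_covers \<Longrightarrow> {P \<in> max_near_transversals. P \<subseteq> C} = {P \<in> near_transversals. P \<subseteq> C}"
  using near_transversal_in_min_cover by (auto simp: max_near_transversals_def)

lemma card_max_in_G2:
  assumes "C \<in> typed_covers G2"
  shows "card {P \<in> max_near_transversals. P \<subseteq> C} = 2"
proof -
  have C: "C \<in> covers" "graph_isomorphic (edge_graph (edges C)) G2" "C \<in> min_covers"
    using assms by (auto simp: typed_covers_def min_covers_eq)
  show ?thesis
    using pair_covers_G2[OF C(2) edges_doubletons[OF C(1)] edges_subset]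
      max_near_transversals_in_min_cover[OF C(3)] card_near_transversals_in_cover[OF C(1)] by simp
qed

lemma card_max_in_G3_G5:
  assumes "C \<in> typed_covers G3 \<union> typed_covers G5"
  shows "card {P \<in> max_near_transversals. P \<subseteq> C} = 3"
proof -
  have C: "C \<in> covers" "C \<in> min_covers"
    "graph_isomorphic (edge_graph (edges C)) G3 \<or> graph_isomorphic (edge_graph (edges C)) G5"
    using assms by (auto simp: typed_covers_def min_covers_eq)
  then have "card (pair_covers C (edges C)) = 3"
    using pair_covers_G3[OF _ edges_doubletons[OF C(1)] edges_subset]
      pair_covers_G5[OF _ edges_doubletons[OF C(1)] edges_subset] by blast
  then show ?thesis
    using max_near_transversals_in_min_cover[OF C(2)] card_near_transversals_in_cover[OF C(1)] by simp
qed

text \<open>Type \<open>G4\<close> is excluded because covers of that type are not minimal, and type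
  \<open>G1\<close> because no two vertices meet three disjoint edges.\<close>

lemma cover_of_max_type:
  assumes "C \<in> covers" "P \<in> max_near_transversals" "P \<subseteq> C"
  shows "C \<in> typed_covers G2 \<union> (typed_covers G3 \<union> typed_covers G5)"
proof -
  have P: "P \<in> near_transversals" using assms(2) by (simp add: max_near_transversals_def)
  then have "C \<in> min_covers" using near_transversal_in_nonmin_cover assms by blast
  moreover have "C \<notin> typed_covers G1"
  proof
    assume "C \<in> typed_covers G1"
    then have "pair_covers C (edges C) = {}"
      by (intro pair_covers_G1 edges_doubletons[OF assms(1)]) (simp add: typed_covers_def)
    then show False using near_transversal_iff_pair_cover[OF assms(1,3)] P by blast
  qed
  ultimately show ?thesis unfolding min_covers_eq by blast
qed

end

text \<open>Here \<open>m k\<close> is the coordinate that \<open>P\<close> misses on axis \<open>k\<close>, and \<open>u k\<close> is the entry that takes the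
  missing coordinates on both axes other than \<open>k\<close>.\<close>

locale maximal_near_transversal = orthogonal_array n E coord vals
  for n :: nat and E :: "'e set" and coord :: "axis \<Rightarrow> 'e \<Rightarrow> 'v" and vals :: "axis \<Rightarrow> 'v set" +
  fixes P :: "'e set" and m :: "axis \<Rightarrow> 'v" and u :: "axis \<Rightarrow> 'e"
  assumes P_max: "P \<in> max_near_transversals"
    and missing: "vals k - coord k ` P = {m k}"
    and u_entry: "u k \<in> E"
    and u_coord: "l \<noteq> k \<Longrightarrow> coord l (u k) = m l"
begin

lemma P_near: "P \<in> near_transversals"
  using P_max by (simp add: max_near_transversals_def)

lemma P_subset: "P \<subseteq> E" and P_inj: "inj_on (coord k) P" and card_P: "card P + 1 = n"
  using P_near by (auto simp: near_transversals_def separated_def)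

lemma finite_P: "finite P"
  using P_subset finite_entries finite_subset by blast

lemma m_vals: "m k \<in> vals k" and m_notin: "m k \<notin> coord k ` P"
  using missing[of k] by auto

lemma vals_cases:
  assumes "x \<in> vals k" "x \<noteq> m k"
  obtains g where "g \<in> P" "coord k g = x"
  using assms missing[of k] by blast

text \<open>An entry taking all three missing values could be added to \<open>P\<close>, against
  maximality.\<close>

lemma no_completion:
  assumes "e \<in> E" "\<And>k. coord k e = m k"
  shows False
proof -
  have "e \<notin> P" using assms(2) m_notin by (metis imageI)
  moreover have "inj_on (coord k) (insert e P)" for k
    using P_inj[of k] m_notin[of k] assms(2)[of k] by auto
  then have "separated (insert e P)" using assms(1) P_subset by (simp add: separated_def)
  ultimately show False
    using P_max assms(1) by (simp add: max_near_transversals_def)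
qed

lemma u_coord_same: "coord k (u k) \<noteq> m k"
  using no_completion[OF u_entry[of k]] u_coord by metis

lemma u_neq: "k \<noteq> l \<Longrightarrow> u k \<noteq> u l"
  using u_coord u_coord_same by metis

lemma u_notin: "u k \<notin> P"
proof -
  obtain l where "l \<noteq> k" by (rule other_axes)
  then show ?thesis using u_coord m_notin by (metis imageI)
qed

lemma eq_u:
  assumes "e \<in> E" "coord l e = m l" "coord j e = m j" "l \<noteq> j" "l \<noteq> k" "j \<noteq> k"
  shows "e = u k"
  using assms u_coord by (intro coord_eqI[of e "u k" l j]) (auto simp: u_entry)

section \<open>Extending a maximal partial transversal to a cover\<close>

text \<open>These turn out to be the pairs whose addition to \<open>P\<close> gives an
  \<open>(n + 1)\<close>-cover; see \<open>bij_extensions_covers\<close>.\<close>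

definition extensions :: "'e set set" where
  "extensions = {W. W \<subseteq> E \<and> card W = 2 \<and> (\<forall>k. m k \<in> coord k ` W)}"

definition core :: "'e set set" where
  "core = {{u Row, u Col}, {u Row, u Symb}, {u Col, u Symb}}"

text \<open>Such an entry can supply the one missing value that \<open>u k\<close> lacks. The
  entries \<open>u l\<close> are set apart because they pair with \<open>u k\<close> inside
  \<open>core\<close>.\<close>

definition free_entries :: "axis \<Rightarrow> 'e set" where
  "free_entries k = {f \<in> E. coord k f = m k} - range u"

definition outer :: "axis \<Rightarrow> 'e set set" where
  "outer k = (\<lambda>f. {u k, f}) ` free_entries k"

lemma free_entries_notin:
  assumes "f \<in> free_entries k"
  shows "f \<in> E" "coord k f = m k" "f \<notin> range u" "f \<notin> P" "l \<noteq> k \<Longrightarrow> coord l f \<noteq> m l"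
proof -
  show f: "f \<in> E" "coord k f = m k" "f \<notin> range u" using assms by (auto simp: free_entries_def)
  then show "f \<notin> P" using m_notin by (metis imageI)
  assume "l \<noteq> k"
  \<comment> \<open>A second missing value would make \<open>f\<close> equal to
    \<open>u j\<close>.\<close>
  then obtain j where "j \<noteq> l" "j \<noteq> k" by (metis third_axis)
  then show "coord l f \<noteq> m l" using eq_u[of f l k j] f \<open>l \<noteq> k\<close> by auto
qed

lemma u_not_free: "u l \<notin> free_entries k"
  by (simp add: free_entries_def)

lemma core_iff: "W \<in> core \<longleftrightarrow> (\<exists>k l. k \<noteq> l \<and> W = {u k, u l})"
proof
  assume "W \<in> core"
  then show "\<exists>k l. k \<noteq> l \<and> W = {u k, u l}"
    unfolding core_def using axis.distinct(1,3,5) by blast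
next
  assume "\<exists>k l. k \<noteq> l \<and> W = {u k, u l}"
  then obtain k l where "k \<noteq> l" "W = {u k, u l}" by blast
  then show "W \<in> core" unfolding core_def by (cases k; cases l) auto
qed

lemma pair_extension:
  assumes "k \<noteq> l"
  shows "{u k, u l} \<in> extensions"
proof -
  have "m i \<in> coord i ` {u k, u l}" for i
    using u_coord[of i k] u_coord[of i l] assms by force
  then show ?thesis using u_entry u_neq[OF assms] by (auto simp: extensions_def)
qed

lemma outer_extension:
  assumes "f \<in> free_entries k"
  shows "{u k, f} \<in> extensions"
proof -
  have "m i \<in> coord i ` {u k, f}" for i
    using u_coord[of i k] free_entries_notin(2)[OF assms] by force
  moreover have "u k \<noteq> f" using free_entries_notin(3)[OF assms] by blast
  ultimately show ?thesis
    using u_entry free_entries_notin(1)[OF assms] by (auto simp: extensions_def)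
qed

text \<open>Since \<open>u k\<close> lacks the missing value of axis \<open>k\<close>, its partner
  must supply it.\<close>

lemma extension_with_u:
  assumes "W \<in> extensions" "u k \<in> W"
  shows "W \<in> core \<union> outer k"
proof -
  obtain f where f: "W = {u k, f}" "u k \<noteq> f"
    using assms by (auto simp: extensions_def elim: card_2_memE)
  have "f \<in> E" "m k \<in> coord k ` {u k, f}" using assms f by (auto simp: extensions_def)
  then have fm: "f \<in> E" "coord k f = m k" using u_coord_same[of k] by auto
  show ?thesis
  proof (cases "f \<in> range u")
    case True
    then obtain l where l: "f = u l" by blast
    then have "k \<noteq> l" using f(2) by auto
    then have "W \<in> core" unfolding core_iff f(1) l by blast
    then show ?thesis by (rule UnI1)
  next
    case False
    then show ?thesis using fm f by (auto simp: outer_def free_entries_def)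
  qed
qed

text \<open>The two added entries share three missing coordinates, so one of them takes two.\<close>

lemma extensions_eq: "extensions = core \<union> (\<Union>k. outer k)"
proof
  show "core \<union> (\<Union>k. outer k) \<subseteq> extensions"
    using pair_extension outer_extension core_iff by (auto simp: outer_def)
  show "extensions \<subseteq> core \<union> (\<Union>k. outer k)"
  proof
    fix W assume W: "W \<in> extensions"
    then obtain e f where ef: "W = {e, f}" "W \<subseteq> E" by (auto simp: extensions_def card_2_iff)
    have "coord k e = m k \<or> coord k f = m k" for k
    proof -
      have "m k \<in> coord k ` {e, f}" using W ef(1) by (simp add: extensions_def)
      then show ?thesis by auto
    qed
    then have "\<exists>k l x. k \<noteq> l \<and> x \<in> W \<and> coord k x = m k \<and> coord l x = m l"
      unfolding ef(1) by (metis axis.distinct(1,3,5) insertCI)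
    then obtain k l x where x: "k \<noteq> l" "x \<in> W" "coord k x = m k" "coord l x = m l" by blast
    obtain j where "j \<noteq> k" "j \<noteq> l" using x(1) by (rule third_axis)
    then have "x = u j" using x ef by (intro eq_u[of x k l j]) auto
    then show "W \<in> core \<union> (\<Union>k. outer k)" using extension_with_u[OF W] x(2) by blast
  qed
qed

lemma card_core: "card core = 3"
  using u_neq[of Row Col] u_neq[of Row Symb] u_neq[of Col Symb]
  by (auto simp: core_def card_insert_if doubleton_eq_iff)

text \<open>The line of the missing value on axis \<open>k\<close> has \<open>n\<close> entries. It
  contains the other two of the \<open>u\<close> entries but not \<open>u k\<close>, which leaves
  \<open>n - 2\<close> free ones.\<close>

lemma card_outer: "card (outer k) + 2 = n"
proof -
  obtain l j where lj: "l \<noteq> k" "j \<noteq> k" "j \<noteq> l" "UNIV = {k, l, j}" by (rule other_axes)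
  let ?L = "{f \<in> E. coord k f = m k}"
  have "range u = {u k, u l, u j}" unfolding lj(4) by simp
  moreover have "u k \<notin> ?L" "u l \<in> ?L" "u j \<in> ?L"
    using lj(1,2) u_entry u_coord[of k l] u_coord[of k j] u_coord_same by auto
  ultimately have "?L \<inter> range u = {u l, u j}"
    by (simp only: Int_insert_right if_True if_False Int_empty_right simp_thms)
  then have "free_entries k = ?L - {u l, u j}" "{u l, u j} \<subseteq> ?L" by (auto simp: free_entries_def)
  moreover have "card ?L = n" using card_line m_vals by blast
  moreover have "finite ?L" using finite_entries by simp
  moreover have "card {u l, u j} = 2" using u_neq[OF lj(3)] by auto
  ultimately have "card (free_entries k) + 2 = n"
    by (metis card_Diff_subset card_mono finite.emptyI finite.insertI le_add_diff_inverse2)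
  moreover have "inj_on (\<lambda>f. {u k, f}) (free_entries k)"
    by (rule inj_onI) (auto simp: doubleton_eq_iff)
  ultimately show ?thesis by (simp add: outer_def card_image)
qed

lemma core_outer_disjoint: "core \<inter> outer k = {}"
  by (auto simp: outer_def core_def doubleton_eq_iff u_not_free)

lemma outer_disjoint: "k \<noteq> l \<Longrightarrow> outer k \<inter> outer l = {}"
  using u_neq[of k l] by (auto simp: outer_def doubleton_eq_iff u_not_free)

lemma finite_extensions: "finite extensions"
  by (rule finite_subset[of _ "Pow E"]) (auto simp: extensions_def finite_entries)

lemma finite_core: "finite core"
  by (simp add: core_def)

lemma finite_outer: "finite (outer k)"
  using finite_entries by (simp add: outer_def free_entries_def)

text \<open>The total is \<open>3 + 3 * (n - 2) = 3 * n - 3\<close>.\<close>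

lemma card_extensions: "card extensions + 3 = 3 * n"
proof -
  have "card (\<Union>k. outer k) = (\<Sum>k\<in>UNIV. card (outer k))"
    by (rule card_UN_disjoint) (simp_all add: UNIV_axis finite_outer outer_disjoint)
  then have "card (\<Union>k. outer k) = card (outer Row) + card (outer Col) + card (outer Symb)"
    by (simp add: UNIV_axis)
  moreover have "card extensions = card core + card (\<Union>k. outer k)"
    unfolding extensions_eq using core_outer_disjoint finite_core finite_outer
    by (intro card_Un_disjoint) (auto simp: UNIV_axis)
  ultimately show ?thesis
    using card_core card_outer[of Row] card_outer[of Col] card_outer[of Symb] by simp
qed

text \<open>An entry of \<open>P\<close> has no missing value, so its partner would need all three,
  which \<open>no_completion\<close> forbids.\<close>

lemma extension_disjoint:
  assumes W: "W \<in> extensions"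
  shows "W \<inter> P = {}"
proof (rule ccontr)
  assume "W \<inter> P \<noteq> {}"
  then obtain e where e: "e \<in> W" "e \<in> P" by blast
  then obtain f where f: "W = {e, f}"
    using W by (auto simp: extensions_def elim: card_2_memE)
  have "coord k f = m k" for k
  proof -
    have "m k \<in> coord k ` {e, f}" using W f by (auto simp: extensions_def)
    moreover have "coord k e \<noteq> m k" using e(2) m_notin by (metis imageI)
    ultimately show ?thesis by auto
  qed
  moreover have "f \<in> E" using W f by (auto simp: extensions_def)
  ultimately show False using no_completion by blast
qed

lemma vals_eq: "vals k = insert (m k) (coord k ` P)"
proof -
  have "coord k ` P \<subseteq> vals k" using P_subset coord_vals by blast
  then show ?thesis using missing[of k] by blast
qed

lemma extension_cover:
  assumes W: "W \<in> extensions"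
  shows "P \<union> W \<in> covers"
proof -
  have "finite W" using W finite_entries finite_subset by (auto simp: extensions_def)
  then have "card (P \<union> W) = n + 1"
    using W extension_disjoint[OF W] finite_P card_P by (subst card_Un_disjoint) (auto simp: extensions_def)
  moreover have "coord k ` (P \<union> W) = vals k" for k
  proof
    show "coord k ` (P \<union> W) \<subseteq> vals k"
      using W P_subset coord_vals by (auto simp: extensions_def)
    show "vals k \<subseteq> coord k ` (P \<union> W)"
      using W unfolding vals_eq by (auto simp: extensions_def)
  qed
  ultimately show ?thesis using W P_subset by (auto simp: covers_def is_cover_def extensions_def)
qed

lemma cover_extension:
  assumes C: "C \<in> covers" "P \<subseteq> C"
  shows "C - P \<in> extensions"
proof -
  note CD = coversD[OF C(1)]
  have "card (C - P) = 2" using CD(3) card_P finite_P C(2) by (simp add: card_Diff_subset)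
  moreover have "m k \<in> coord k ` (C - P)" for k
  proof -
    obtain e where e: "e \<in> C" "coord k e = m k" using CD(2)[of k] m_vals[of k] by force
    then have "e \<notin> P" using m_notin[of k] by force
    then show ?thesis using e by force
  qed
  ultimately show ?thesis using CD(1) by (auto simp: extensions_def)
qed

lemma bij_extensions_covers: "bij_betw (\<lambda>W. P \<union> W) extensions {C \<in> covers. P \<subseteq> C}"
  unfolding bij_betw_def
proof
  show "inj_on (\<lambda>W. P \<union> W) extensions"
  proof (rule inj_onI)
    fix V W assume "V \<in> extensions" "W \<in> extensions" "P \<union> V = P \<union> W"
    then have "V = (P \<union> V) - P" "W = (P \<union> V) - P" using extension_disjoint by blast+
    then show "V = W" by simp
  qed
  have "C \<in> (\<lambda>W. P \<union> W) ` extensions" if "C \<in> covers" "P \<subseteq> C" for C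
  proof (rule image_eqI)
    show "C = P \<union> (C - P)" using that(2) by blast
  qed (rule cover_extension[OF that])
  then show "(\<lambda>W. P \<union> W) ` extensions = {C \<in> covers. P \<subseteq> C}"
    using extension_cover by blast
qed

section \<open>Covers of types \<open>G3\<close> and \<open>G5\<close> above a maximal partial
  transversal\<close>

text \<open>The two types are grouped because each of their covers contains three maximal partial
  transversals of deficit 1, against two for \<open>G2\<close>.\<close>

abbreviation special :: "'e set set" where
  "special \<equiv> typed_covers G3 \<union> typed_covers G5"

text \<open>\<open>u k\<close> and \<open>u l\<close> agree on the third axis, and each meets an
  entry of \<open>P\<close> on its own axis. The edges form the path \<open>g\<close>,
  \<open>u k\<close>, \<open>u l\<close>, \<open>h\<close>, which closes to a triangle when
  \<open>g = h\<close>.\<close>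

lemma core_special:
  assumes "W \<in> core"
  shows "P \<union> W \<in> special"
proof -
  obtain k l where kl: "k \<noteq> l" "W = {u k, u l}" using assms core_iff by blast
  obtain j where j: "j \<noteq> k" "j \<noteq> l" "UNIV = {k, l, j}" using kl(1) by (rule third_axis)
  have C: "P \<union> W \<in> covers" unfolding kl(2) by (intro extension_cover pair_extension kl(1))
  have uC: "u k \<in> P \<union> W" "u l \<in> P \<union> W" using kl by auto
  \<comment> \<open>By \<open>u_coord_same\<close> this value is not the missing one, so some entry
    of \<open>P\<close> takes it.\<close>
  obtain g where g: "g \<in> P" "coord k g = coord k (u k)"
    by (rule vals_cases[OF coord_vals[OF u_entry] u_coord_same])
  obtain h where h: "h \<in> P" "coord l h = coord l (u l)"
    by (rule vals_cases[OF coord_vals[OF u_entry] u_coord_same])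
  have neq: "u k \<noteq> u l" "g \<noteq> u k" "g \<noteq> u l" "h \<noteq> u k" "h \<noteq> u l"
    using g(1) h(1) u_notin u_neq[OF kl(1)] by auto
  have "repeated (P \<union> W) k = {g, u k}" using repeated_eq(1)[OF C, of g "u k" k] g neq uC by simp
  moreover have "repeated (P \<union> W) l = {u l, h}"
    using repeated_eq(1)[OF C, of "u l" h l] h neq uC by auto
  moreover have "repeated (P \<union> W) j = {u k, u l}"
    using repeated_eq(1)[OF C uC neq(1), of j] u_coord j by simp
  ultimately have edges: "edges (P \<union> W) = {{g, u k}, {u k, u l}, {u l, h}}"
    unfolding j(3) by auto
  show ?thesis
  proof (cases "g = h")
    case True
    then have "edges (P \<union> W) = {{g, u k}, {u k, u l}, {g, u l}}" using edges by auto
    then show ?thesis using isomorphic_G5I[of g "u k" "u l"] neq C by (simp add: typed_covers_def)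
  next
    case False
    then show ?thesis
      using isomorphic_G3I[of g "u k" "u l" h] neq C edges by (simp add: typed_covers_def)
  qed
qed

text \<open>Here \<open>f\<close> meets entries \<open>h\<close> and \<open>i\<close> of
  \<open>P\<close> on the axes \<open>l\<close> and \<open>j\<close>. If neither is
  \<open>g\<close>, the edges are a path through \<open>f\<close> and a disjoint edge from
  \<open>g\<close> to \<open>u k\<close>, so the type is \<open>G2\<close>.\<close>

lemma outer_special:
  assumes f: "f \<in> free_entries k" and sp: "P \<union> {u k, f} \<in> special"
    and g: "g \<in> P" "coord k g = coord k (u k)" and lj: "l \<noteq> k" "j \<noteq> k" "j \<noteq> l"
  shows "coord l f = coord l g \<or> coord j f = coord j g"
proof (rule ccontr)
  assume neg: "\<not> ?thesis"
  let ?C = "P \<union> {u k, f}"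
  have C: "?C \<in> covers" using sp by (auto simp: typed_covers_def)
  note fD = free_entries_notin[OF f]
  obtain h where h: "h \<in> P" "coord l h = coord l f"
    by (rule vals_cases[OF coord_vals[OF fD(1)] fD(5)[OF lj(1)]])
  obtain i where i: "i \<in> P" "coord j i = coord j f"
    by (rule vals_cases[OF coord_vals[OF fD(1)] fD(5)[OF lj(2)]])
  \<comment> \<open>A common entry would agree with \<open>f\<close> on two axes and put
    \<open>f\<close> into \<open>P\<close>.\<close>
  have "h \<noteq> i"
  proof
    assume "h = i"
    then have "h = f" using h i fD(1) lj P_subset by (intro coord_eqI[of h f l j]) auto
    then show False using h(1) fD(4) by simp
  qed
  moreover have "g \<noteq> h" "g \<noteq> i" using neg h(2) i(2) by auto
  moreover have "g \<noteq> u k" "h \<noteq> u k" "i \<noteq> u k" using g(1) h(1) i(1) u_notin by auto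
  moreover have "g \<noteq> f" "h \<noteq> f" "i \<noteq> f" "u k \<noteq> f" using g(1) h(1) i(1) fD(3,4) by auto
  ultimately have neq: "distinct [h, f, i, g, u k]" by auto
  have "repeated ?C l = {h, f}" using repeated_eq(1)[OF C, of h f l] h neq by simp
  moreover have "repeated ?C j = {f, i}" using repeated_eq(1)[OF C, of f i j] i neq by auto
  moreover have "repeated ?C k = {g, u k}" using repeated_eq(1)[OF C, of g "u k" k] g neq by simp
  moreover have "UNIV = {k, l, j}" using lj unfolding UNIV_axis by (cases k; cases l; cases j) auto
  ultimately have "edges ?C = {{h, f}, {f, i}, {g, u k}}" by auto
  then have "?C \<in> typed_covers G2" using isomorphic_G2I[OF neq] C by (simp add: typed_covers_def)
  moreover have "typed_covers G2 \<inter> special = {}"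
    by (simp add: Int_Un_distrib typed_covers_disjoint card_vertices_G)
  ultimately show False using sp by blast
qed

text \<open>By \<open>outer_special\<close>, \<open>f\<close> has the missing value on axis
  \<open>k\<close> and agrees with the fixed entry \<open>g\<close> on one of two axes. Either
  agreement determines \<open>f\<close>; the candidates are \<open>a\<close> and
  \<open>b\<close>.\<close>

lemma card_outer_special: "card {W \<in> outer k. P \<union> W \<in> special} \<le> 2"
proof -
  obtain l j where lj: "l \<noteq> k" "j \<noteq> k" "j \<noteq> l" by (rule other_axes)
  obtain g where g: "g \<in> P" "coord k g = coord k (u k)"
    by (rule vals_cases[OF coord_vals[OF u_entry] u_coord_same])
  have "g \<in> E" using g P_subset by blast
  obtain a where a: "\<And>e. \<lbrakk>e \<in> E; coord k e = m k; coord l e = coord l g\<rbrakk> \<Longrightarrow> e = a"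
    using ex1_entry[OF lj(1)[symmetric] m_vals coord_vals[OF \<open>g \<in> E\<close>]] by metis
  obtain b where b: "\<And>e. \<lbrakk>e \<in> E; coord k e = m k; coord j e = coord j g\<rbrakk> \<Longrightarrow> e = b"
    using ex1_entry[OF lj(2)[symmetric] m_vals coord_vals[OF \<open>g \<in> E\<close>]] by metis
  have "W \<in> {{u k, a}, {u k, b}}" if W: "W \<in> outer k" "P \<union> W \<in> special" for W
  proof -
    obtain f where f: "f \<in> free_entries k" "W = {u k, f}" using W(1) by (auto simp: outer_def)
    then have "coord l f = coord l g \<or> coord j f = coord j g"
      using outer_special[OF _ _ g lj] W(2) by blast
    then have "f = a \<or> f = b" using a b free_entries_notin(1,2)[OF f(1)] by blast
    then show ?thesis using f(2) by blast
  qed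
  then have "{W \<in> outer k. P \<union> W \<in> special} \<subseteq> {{u k, a}, {u k, b}}" by blast
  then have "card {W \<in> outer k. P \<union> W \<in> special} \<le> card {{u k, a}, {u k, b}}"
    by (rule card_mono[rotated]) simp
  also have "\<dots> \<le> 2" by (simp add: card_insert_if)
  finally show ?thesis .
qed

text \<open>The three pairs in \<open>core\<close> always count, and each of the three axes adds at
  most two pairs from \<open>outer\<close>.\<close>

lemma card_special_covers:
  "3 \<le> card {C \<in> special. P \<subseteq> C}" "card {C \<in> special. P \<subseteq> C} \<le> 9"
proof -
  let ?A = "{W \<in> extensions. P \<union> W \<in> special}"
  let ?O = "\<lambda>k. {W \<in> outer k. P \<union> W \<in> special}"
  have "bij_betw (\<lambda>W. P \<union> W) ?A {C \<in> special. P \<subseteq> C}"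
  proof (rule bij_betw_subset[OF bij_extensions_covers, of ?A])
    show "?A \<subseteq> extensions" by blast
    show "(\<lambda>W. P \<union> W) ` ?A = {C \<in> special. P \<subseteq> C}"
    proof
      show "(\<lambda>W. P \<union> W) ` ?A \<subseteq> {C \<in> special. P \<subseteq> C}" by auto
      show "{C \<in> special. P \<subseteq> C} \<subseteq> (\<lambda>W. P \<union> W) ` ?A"
      proof
        fix C assume C: "C \<in> {C \<in> special. P \<subseteq> C}"
        then have "C \<in> {C \<in> covers. P \<subseteq> C}" by (auto simp: typed_covers_def)
        then have "C \<in> (\<lambda>W. P \<union> W) ` extensions"
          using bij_extensions_covers by (simp only: bij_betw_def)
        then obtain W where "W \<in> extensions" "C = P \<union> W" by blast
        then show "C \<in> (\<lambda>W. P \<union> W) ` ?A" using C by (intro image_eqI[of C _ W]) simp_all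
      qed
    qed
  qed
  then have eq: "card ?A = card {C \<in> special. P \<subseteq> C}" by (rule bij_betw_same_card)
  have "core \<subseteq> ?A" using core_special extensions_eq by blast
  then have "card core \<le> card ?A" using finite_extensions by (intro card_mono) auto
  then show "3 \<le> card {C \<in> special. P \<subseteq> C}" using eq card_core by simp
  have fin: "finite (?O k)" for k using finite_outer by simp
  have "?A \<subseteq> core \<union> (?O Row \<union> (?O Col \<union> ?O Symb))"
    unfolding extensions_eq UNIV_axis by blast
  then have "card ?A \<le> card (core \<union> (?O Row \<union> (?O Col \<union> ?O Symb)))"
    using fin finite_core by (intro card_mono) simp_all
  also have "\<dots> \<le> card core + (card (?O Row) + (card (?O Col) + card (?O Symb)))"
    by (intro order_trans[OF card_Un_le] add_mono order_refl)
  also have "\<dots> \<le> 9" using card_core card_outer_special[of Row] card_outer_special[of Col]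
      card_outer_special[of Symb] by linarith
  finally show "card {C \<in> special. P \<subseteq> C} \<le> 9" using eq by simp
qed

lemma card_covers_above:
  "card {C \<in> typed_covers G2. P \<subseteq> C} + card {C \<in> special. P \<subseteq> C} + 3 = 3 * n"
proof -
  have sub: "typed_covers G \<subseteq> covers" for G by (auto simp: typed_covers_def)
  have "{C \<in> covers. P \<subseteq> C} = {C \<in> typed_covers G2. P \<subseteq> C} \<union> {C \<in> special. P \<subseteq> C}"
    using cover_of_max_type[OF _ P_max] sub by blast
  moreover have "typed_covers G2 \<inter> special = {}"
    by (simp add: Int_Un_distrib typed_covers_disjoint card_vertices_G)
  then have "{C \<in> typed_covers G2. P \<subseteq> C} \<inter> {C \<in> special. P \<subseteq> C} = {}" by blast
  ultimately have "card {C \<in> covers. P \<subseteq> C} =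
      card {C \<in> typed_covers G2. P \<subseteq> C} + card {C \<in> special. P \<subseteq> C}"
    using finite_typed_covers by (simp add: card_Un_disjoint)
  then show ?thesis
    using bij_betw_same_card[OF bij_extensions_covers] card_extensions by simp
qed

end

section \<open>Double counting of maximal partial transversals against covers\<close>

context orthogonal_array
begin

text \<open>On each axis \<open>P\<close> takes \<open>n - 1\<close> of the \<open>n\<close> values,
  so one is missing. Prescribing the missing values on two axes determines the entry
  \<open>u k\<close>.\<close>

lemma maximal_near_transversal_exists:
  assumes P: "P \<in> max_near_transversals"
  shows "\<exists>m u. maximal_near_transversal n E coord vals P m u"
proof -
  have D: "card P + 1 = n" "P \<subseteq> E" "\<And>k. inj_on (coord k) P"
    using P by (auto simp: max_near_transversals_def near_transversals_def separated_def)
  have "\<exists>x. vals k - coord k ` P = {x}" for k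
  proof -
    have "coord k ` P \<subseteq> vals k" using D(2) coord_vals by blast
    moreover have "finite (coord k ` P)" using calculation finite_vals finite_subset by blast
    moreover have "card (coord k ` P) + 1 = n" using D by (simp add: card_image)
    ultimately have "card (vals k - coord k ` P) = 1"
      using card_vals[of k] by (simp add: card_Diff_subset)
    then show ?thesis by (auto simp: card_1_singleton_iff)
  qed
  then obtain m where m: "\<And>k. vals k - coord k ` P = {m k}" by metis
  have "\<exists>e. e \<in> E \<and> (\<forall>l. l \<noteq> k \<longrightarrow> coord l e = m l)" for k
  proof -
    obtain l j where lj: "l \<noteq> k" "j \<noteq> k" "j \<noteq> l" "UNIV = {k, l, j}" by (rule other_axes)
    have "m l \<in> vals l" "m j \<in> vals j" using m[of l] m[of j] by auto
    then obtain e where "e \<in> E" "coord j e = m j" "coord l e = m l"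
      using ex1_entry[OF lj(3)] by blast
    moreover have "i = l \<or> i = j" if "i \<noteq> k" for i using lj(4) that by blast
    ultimately show ?thesis by metis
  qed
  then obtain u where "\<And>k. u k \<in> E" "\<And>k l. l \<noteq> k \<Longrightarrow> coord l (u k) = m l" by metis
  then have "maximal_near_transversal n E coord vals P m u"
    using P m by unfold_locales auto
  then show ?thesis by blast
qed

lemma finite_near_transversals: "finite near_transversals"
  using finite_separated by (simp add: near_transversals_def)

lemma finite_max_near_transversals: "finite max_near_transversals"
  using finite_near_transversals by (simp add: max_near_transversals_def)

lemma double_count:
  assumes "finite K"
  shows "(\<Sum>P\<in>max_near_transversals. card {C \<in> K. P \<subseteq> C}) =
    (\<Sum>C\<in>K. card {P \<in> max_near_transversals. P \<subseteq> C})"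
  using sum.swap_restrict[OF finite_max_near_transversals assms, of "\<lambda>_ _. 1::nat" "(\<subseteq>)"] by simp

text \<open>Counting pairs \<open>P \<subseteq> C\<close> from both sides gives all three claims.
  The bounds 3 and 9 on special covers above each \<open>P\<close>, divided by the 3 members
  \<open>P\<close> of each special cover, give the factors 1 and 3.\<close>

lemma max_near_transversals_count:
  defines "p \<equiv> card max_near_transversals" and "c2 \<equiv> card (typed_covers G2)"
    and "c3 \<equiv> card (typed_covers G3) + card (typed_covers G5)"
  shows "2 * c2 + 3 * c3 + 3 * p = 3 * n * p" "p \<le> c3" "c3 \<le> 3 * p"
proof -
  let ?S = "typed_covers G3 \<union> typed_covers G5"
  have c2: "(\<Sum>P\<in>max_near_transversals. card {C \<in> typed_covers G2. P \<subseteq> C}) = 2 * c2"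
    by (simp add: double_count finite_typed_covers card_max_in_G2 c2_def)
  have "(\<Sum>P\<in>max_near_transversals. card {C \<in> ?S. P \<subseteq> C}) = (\<Sum>C\<in>?S. 3)"
    using double_count[of ?S] card_max_in_G3_G5 finite_typed_covers by simp
  then have c3: "(\<Sum>P\<in>max_near_transversals. card {C \<in> ?S. P \<subseteq> C}) = 3 * c3"
    by (simp add: card_G3_G5 c3_def)
  have each: "card {C \<in> typed_covers G2. P \<subseteq> C} + card {C \<in> ?S. P \<subseteq> C} + 3 = 3 * n"
    "3 \<le> card {C \<in> ?S. P \<subseteq> C}" "card {C \<in> ?S. P \<subseteq> C} \<le> 9" if P: "P \<in> max_near_transversals" for P
  proof -
    obtain m u where "maximal_near_transversal n E coord vals P m u"
      using maximal_near_transversal_exists[OF P] by blast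
    then interpret maximal_near_transversal n E coord vals P m u .
    show "card {C \<in> typed_covers G2. P \<subseteq> C} + card {C \<in> ?S. P \<subseteq> C} + 3 = 3 * n"
      "3 \<le> card {C \<in> ?S. P \<subseteq> C}" "card {C \<in> ?S. P \<subseteq> C} \<le> 9"
      by (fact card_covers_above card_special_covers)+
  qed
  have "(\<Sum>P\<in>max_near_transversals. card {C \<in> typed_covers G2. P \<subseteq> C} + card {C \<in> ?S. P \<subseteq> C} + 3)
      = (\<Sum>P\<in>max_near_transversals. 3 * n)"
    using each(1) by (intro sum.cong) auto
  then have "2 * c2 + 3 * c3 + (\<Sum>P\<in>max_near_transversals. 3) = (\<Sum>P\<in>max_near_transversals. 3 * n)"
    by (simp only: sum.distrib c2 c3)
  then show "2 * c2 + 3 * c3 + 3 * p = 3 * n * p"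
    by (simp add: p_def mult.commute)
  have "(\<Sum>P\<in>max_near_transversals. 3) \<le> 3 * c3"
    unfolding c3[symmetric] using each(2) by (rule sum_mono)
  then show "p \<le> c3" by (simp add: p_def)
  have "3 * c3 \<le> (\<Sum>P\<in>max_near_transversals. 9)"
    unfolding c3[symmetric] using each(3) by (rule sum_mono)
  then show "c3 \<le> 3 * p" by (simp add: p_def)
qed

section \<open>Bounds involving transversals\<close>

lemma finite_transversals: "finite transversals"
  using finite_separated by (simp add: transversals_def)

text \<open>The non-maximal ones arise by deleting one of the \<open>n\<close> entries of a
  transversal. The same set may arise repeatedly, so this is only an upper bound.\<close>

lemma near_transversals_bound:
  "card near_transversals \<le> card max_near_transversals + n * card transversals"
proof -
  let ?D = "\<Union>T\<in>transversals. (\<lambda>e. T - {e}) ` T"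
  have "near_transversals - max_near_transversals \<subseteq> ?D"
  proof
    fix P assume "P \<in> near_transversals - max_near_transversals"
    then obtain e where e: "e \<notin> P" "separated (insert e P)" "card P + 1 = n" "separated P"
      by (auto simp: max_near_transversals_def near_transversals_def)
    then have "finite P" using finite_entries finite_subset by (auto simp: separated_def)
    then have "insert e P \<in> transversals" using e by (simp add: transversals_def)
    moreover have "P = insert e P - {e}" using e by simp
    ultimately show "P \<in> ?D" by blast
  qed
  then have "near_transversals \<subseteq> max_near_transversals \<union> ?D" by blast
  moreover have T: "finite T" "card T = n" if "T \<in> transversals" for T
    using that finite_entries finite_subset by (auto simp: transversals_def separated_def)
  ultimately have "card near_transversals \<le> card (max_near_transversals \<union> ?D)"
    using finite_max_near_transversals finite_transversals by (intro card_mono) auto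
  also have "\<dots> \<le> card max_near_transversals + card ?D" by (rule card_Un_le)
  also have "card ?D \<le> (\<Sum>T\<in>transversals. card ((\<lambda>e. T - {e}) ` T))"
    using finite_transversals by (rule card_UN_le)
  also have "\<dots> \<le> (\<Sum>T\<in>transversals. n)"
  proof (rule sum_mono)
    fix T assume "T \<in> transversals"
    then show "card ((\<lambda>e. T - {e}) ` T) \<le> n" using card_image_le[OF T(1)] T(2) by metis
  qed
  finally show ?thesis by (simp add: mult.commute)
qed

text \<open>Two redundant entries would lie on all three edges and thereby make the edges
  equal.\<close>

lemma redundant_entry_unique:
  assumes "C \<in> covers" "e \<in> C" "f \<in> C" "is_cover (C - {e})" "is_cover (C - {f})"
  shows "e = f"
proof (rule ccontr)
  assume "e \<noteq> f"
  have "repeated C k = {e, f}" for k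
  proof -
    have "e \<in> repeated C k" "f \<in> repeated C k" using is_cover_remove_iff assms by blast+
    then show ?thesis using \<open>e \<noteq> f\<close> card_repeated[OF assms(1)] by (auto elim!: card_2_memE)
  qed
  then show False using repeated_neq[OF assms(1), of Row Col] by simp
qed

text \<open>A transversal with one of the \<open>n * n - n\<close> other entries added is a
  non-minimal cover. The map is injective because the added entry is redundant, hence recoverable by
  \<open>redundant_entry_unique\<close>.\<close>

lemma covers_bound:
  "card min_covers + card transversals * (n * n - n) \<le> card covers"
proof -
  let ?A = "Sigma transversals (\<lambda>T. E - T)"
  let ?F = "\<lambda>(T, f). insert f T"
  have T: "finite T" "card T = n" "T \<subseteq> E" "is_cover T" if "T \<in> transversals" for T
    using that finite_entries finite_subset separated_card_n_iff_is_cover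
    by (auto simp: transversals_def separated_def)
  have cov: "insert f T \<in> covers" if "T \<in> transversals" "f \<in> E - T" for T f
    using T[OF that(1)] that(2) coord_vals by (auto simp: covers_def is_cover_def)
  have "card (E - T) = n * n - n" if "T \<in> transversals" for T
    using T[OF that] card_entries by (simp add: card_Diff_subset)
  then have "card ?A = card transversals * (n * n - n)"
    using finite_transversals finite_entries by (simp add: card_SigmaI)
  moreover have "inj_on ?F ?A"
  proof (rule inj_onI, clarify)
    fix T f T' f'
    assume a: "T \<in> transversals" "f \<in> E" "f \<notin> T" "T' \<in> transversals" "f' \<in> E" "f' \<notin> T'"
      and eq: "insert f T = insert f' T'"
    have TT: "insert f T - {f} = T" "insert f T - {f'} = T'" using a eq by auto
    have "f = f'"
      using redundant_entry_unique[OF cov[of T f], of f f'] TT T(4) a eq by auto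
    then show "T = T' \<and> f = f'" using TT by simp
  qed
  moreover have "?F ` ?A \<subseteq> covers - min_covers"
  proof clarify
    fix T f assume a: "T \<in> transversals" "f \<in> E" "f \<notin> T"
    have "insert f T - {f} = T" using a by simp
    then have "is_cover (insert f T - {f})" using T(4)[OF a(1)] by simp
    then have "insert f T \<notin> min_covers" by (auto simp: min_covers_def)
    then show "insert f T \<in> covers - min_covers" using cov a by simp
  qed
  ultimately have "card transversals * (n * n - n) \<le> card (covers - min_covers)"
    using finite_covers by (metis card_inj_on_le finite_Diff)
  moreover have "card (covers - min_covers) + card min_covers = card covers"
    using finite_covers by (metis (no_types, lifting) card_Diff_subset card_mono finite_subset
        le_add_diff_inverse2 mem_Collect_eq min_covers_def subsetI)
  ultimately show ?thesis by linarith
qed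

end

section \<open>Latin squares as orthogonal arrays\<close>

text \<open>The sum type gives row and column indices and symbols a common type. Rows and columns
  may share values since lines are always indexed by an axis as well.\<close>

fun entry_coord :: "axis \<Rightarrow> 's entry \<Rightarrow> nat + 's" where
  "entry_coord Row e = Inl (row_of e)"
| "entry_coord Col e = Inl (col_of e)"
| "entry_coord Symb e = Inr (sym_of e)"

fun entry_vals :: "nat \<Rightarrow> 's set \<Rightarrow> axis \<Rightarrow> (nat + 's) set" where
  "entry_vals n S Row = Inl ` {..<n}"
| "entry_vals n S Col = Inl ` {..<n}"
| "entry_vals n S Symb = Inr ` S"

lemma lines_eq:
  "lines n S L = {{e \<in> entries n L. entry_coord k e = x} | k x. x \<in> entry_vals n S k}"
proof -
  have "{{e \<in> entries n L. entry_coord k e = x} | k x. x \<in> entry_vals n S k} =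
      (\<Union>k. (\<lambda>x. {e \<in> entries n L. entry_coord k e = x}) ` entry_vals n S k)"
    by blast
  also have "\<dots> = lines n S L"
    by (auto simp: UNIV_axis lines_def)
  finally show ?thesis ..
qed

text \<open>Row and column determine an entry by the form of \<open>entries\<close>; the pairs
  involving the symbol use the two uniqueness conditions of a Latin square.\<close>

lemma latin_square_orthogonal_array:
  assumes L: "latin_square n S L" and "0 < n"
  shows "orthogonal_array n (entries n L) entry_coord (entry_vals n S)"
proof
  show "0 < n" by fact
  have S: "card S = n" "\<And>i j. \<lbrakk>i < n; j < n\<rbrakk> \<Longrightarrow> L i j \<in> S"
    "\<And>i s. \<lbrakk>i < n; s \<in> S\<rbrakk> \<Longrightarrow> \<exists>!j. j < n \<and> L i j = s"
    "\<And>j s. \<lbrakk>j < n; s \<in> S\<rbrakk> \<Longrightarrow> \<exists>!i. i < n \<and> L i j = s"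
    using L unfolding latin_square_def by simp_all
  show "card (entry_vals n S k) = n" for k
    by (cases k) (simp_all add: card_image S(1))
  show "entry_coord k e \<in> entry_vals n S k" if "e \<in> entries n L" for e k
    using that S(2) by (cases k) (auto simp: entries_def row_of_def col_of_def sym_of_def)
  fix k l x y
  assume kl: "k \<noteq> l" and x: "x \<in> entry_vals n S k" and y: "y \<in> entry_vals n S l"
  let ?Q = "\<lambda>k l x y. \<exists>!e. e \<in> entries n L \<and> entry_coord k e = x \<and> entry_coord l e = y"
  have RC: "?Q Row Col (Inl i) (Inl j)" if "i < n" "j < n" for i j
    using that by (intro ex1I[of _ "(i, j, L i j)"])
      (auto simp: entries_def row_of_def col_of_def sym_of_def)
  have RS: "?Q Row Symb (Inl i) (Inr s)" if assm: "i < n" "s \<in> S" for i s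
  proof -
    obtain j where ij: "j < n" "L i j = s" "\<And>j'. \<lbrakk>j' < n; L i j' = s\<rbrakk> \<Longrightarrow> j' = j"
      using S(3)[OF assm] by blast
    show ?thesis
    proof (rule ex1I)
      show "(i, j, s) \<in> entries n L \<and> entry_coord Row (i, j, s) = Inl i \<and>
          entry_coord Symb (i, j, s) = Inr s"
        using assm ij(1,2) by (auto simp: entries_def row_of_def col_of_def sym_of_def)
      fix e assume "e \<in> entries n L \<and> entry_coord Row e = Inl i \<and> entry_coord Symb e = Inr s"
      then obtain j' where "e = (i, j', L i j')" "j' < n" "L i j' = s"
        by (auto simp: entries_def row_of_def col_of_def sym_of_def)
      then show "e = (i, j, s)" using ij(3)[of j'] by simp
    qed
  qed
  have CS: "?Q Col Symb (Inl j) (Inr s)" if assm: "j < n" "s \<in> S" for j s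
  proof -
    obtain i where ij: "i < n" "L i j = s" "\<And>i'. \<lbrakk>i' < n; L i' j = s\<rbrakk> \<Longrightarrow> i' = i"
      using S(4)[OF assm] by blast
    show ?thesis
    proof (rule ex1I)
      show "(i, j, s) \<in> entries n L \<and> entry_coord Col (i, j, s) = Inl j \<and>
          entry_coord Symb (i, j, s) = Inr s"
        using assm ij(1,2) by (auto simp: entries_def row_of_def col_of_def sym_of_def)
      fix e assume "e \<in> entries n L \<and> entry_coord Col e = Inl j \<and> entry_coord Symb e = Inr s"
      then obtain i' where "e = (i', j, L i' j)" "i' < n" "L i' j = s"
        by (auto simp: entries_def row_of_def col_of_def sym_of_def)
      then show "e = (i, j, s)" using ij(3)[of i'] by simp
    qed
  qed
  \<comment> \<open>Exchanging the axes reduces the six ordered pairs to three.\<close>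
  have swap: "?Q k l x y \<longleftrightarrow> ?Q l k y x" for k l x y by (simp only: conj_commute)
  have fwd: "?Q Row Col x y" if xy: "x \<in> entry_vals n S Row" "y \<in> entry_vals n S Col" for x y
  proof -
    obtain i j where "i < n" "j < n" "x = Inl i" "y = Inl j" using xy by auto
    then show ?thesis using RC by (simp only:)
  qed
  have fwd': "?Q Row Symb x y" if xy: "x \<in> entry_vals n S Row" "y \<in> entry_vals n S Symb" for x y
  proof -
    obtain i s where "i < n" "s \<in> S" "x = Inl i" "y = Inr s" using xy by auto
    then show ?thesis using RS by (simp only:)
  qed
  have fwd'': "?Q Col Symb x y" if xy: "x \<in> entry_vals n S Col" "y \<in> entry_vals n S Symb" for x y
  proof -
    obtain j s where "j < n" "s \<in> S" "x = Inl j" "y = Inr s" using xy by auto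
    then show ?thesis using CS by (simp only:)
  qed
  from x y kl show "?Q k l x y"
    by (cases k; cases l) (simp_all only: fwd fwd' fwd'' swap[of Col _ Row] swap[of Symb _ Row] swap[of Symb _ Col] simp_thms)
qed

locale latin_square_array =
  fixes n :: nat and S :: "'s set" and L :: "nat \<Rightarrow> nat \<Rightarrow> 's"
  assumes latin: "latin_square n S L" and order_pos: "0 < n"
begin

sublocale orthogonal_array n "entries n L" entry_coord "entry_vals n S"
  using latin order_pos by (rule latin_square_orthogonal_array)

section \<open>The counted quantities in the orthogonal array\<close>

lemma cover_iff: "cover n S L C \<longleftrightarrow> is_cover C"
proof -
  have "(\<forall>l\<in>lines n S L. C \<inter> l \<noteq> {}) \<longleftrightarrow> (\<forall>k. entry_coord k ` C = entry_vals n S k)"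
    if "C \<subseteq> entries n L"
  proof -
    have "(\<forall>l\<in>lines n S L. C \<inter> l \<noteq> {}) \<longleftrightarrow>
        (\<forall>k. \<forall>x\<in>entry_vals n S k. C \<inter> {e \<in> entries n L. entry_coord k e = x} \<noteq> {})"
      unfolding lines_eq by blast
    also have "\<dots> \<longleftrightarrow> (\<forall>k. entry_vals n S k \<subseteq> entry_coord k ` C)"
    proof -
      have "C \<inter> {e \<in> entries n L. entry_coord k e = x} \<noteq> {} \<longleftrightarrow> x \<in> entry_coord k ` C" for k x
        using that by auto
      then show ?thesis by (simp only: subset_iff Ball_def)
    qed
    also have "\<dots> \<longleftrightarrow> (\<forall>k. entry_coord k ` C = entry_vals n S k)"
    proof -
      have "entry_coord k ` C \<subseteq> entry_vals n S k" for k using that coord_vals by blast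
      then show ?thesis by (simp add: set_eq_subset)
    qed
    finally show ?thesis .
  qed
  then show ?thesis by (auto simp: cover_def is_cover_def)
qed

lemma lines_at_most_once_iff:
  assumes "P \<subseteq> entries n L"
  shows "lines_at_most_once n S L P \<longleftrightarrow> separated P"
proof -
  \<comment> \<open>Finiteness matters because \<open>card\<close> is 0 on infinite sets, where the
    bound by 1 would say nothing.\<close>
  have "finite P" using assms finite_entries finite_subset by blast
  then have le1: "card (P \<inter> l) \<le> 1 \<longleftrightarrow> (\<forall>a\<in>P \<inter> l. \<forall>b\<in>P \<inter> l. a = b)" for l
    using card_le_Suc0_iff_eq[of "P \<inter> l"] by simp
  have "lines_at_most_once n S L P \<longleftrightarrow>
      (\<forall>k. \<forall>x\<in>entry_vals n S k. \<forall>a\<in>P. \<forall>b\<in>P. entry_coord k a = x \<longrightarrow> entry_coord k b = x \<longrightarrow> a = b)"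
  proof -
    have "card (P \<inter> {e \<in> entries n L. entry_coord k e = x}) \<le> 1 \<longleftrightarrow>
        (\<forall>a\<in>P. \<forall>b\<in>P. entry_coord k a = x \<longrightarrow> entry_coord k b = x \<longrightarrow> a = b)" for k x
    proof -
      have P_line: "P \<inter> {e \<in> entries n L. entry_coord k e = x} = {e \<in> P. entry_coord k e = x}"
        using assms by auto
      show ?thesis unfolding le1 unfolding P_line by blast
    qed
    moreover have "lines_at_most_once n S L P \<longleftrightarrow>
        (\<forall>k. \<forall>x\<in>entry_vals n S k. card (P \<inter> {e \<in> entries n L. entry_coord k e = x}) \<le> 1)"
      unfolding lines_at_most_once_def lines_eq by blast
    ultimately show ?thesis by (simp only:)
  qed
  also have "\<dots> \<longleftrightarrow> (\<forall>k. inj_on (entry_coord k) P)"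
  proof -
    have "entry_coord k a \<in> entry_vals n S k" if "a \<in> P" for k a
      using that assms coord_vals by blast
    then show ?thesis unfolding inj_on_def by (metis (no_types))
  qed
  finally show ?thesis using assms by (simp add: separated_def)
qed

lemma partial_transversal_iff:
  "partial_transversal n S L d P \<longleftrightarrow> separated P \<and> card P + d = n"
  using lines_at_most_once_iff by (auto simp: partial_transversal_def separated_def)

lemma maximal_partial_transversal_iff:
  "maximal_partial_transversal n S L 1 P \<longleftrightarrow> P \<in> max_near_transversals"
proof -
  have "lines_at_most_once n S L (insert e P) \<longleftrightarrow> separated (insert e P)"
    if "P \<in> near_transversals" "e \<in> entries n L" for e
    using that by (intro lines_at_most_once_iff) (auto simp: near_transversals_def separated_def)
  then show ?thesis
    by (auto simp: maximal_partial_transversal_def max_near_transversals_def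
        near_transversals_def partial_transversal_iff)
qed

lemma latin_square_graph_edge_iff:
  "{e, f} \<in> snd (latin_square_graph n L) \<longleftrightarrow>
    e \<in> entries n L \<and> f \<in> entries n L \<and> e \<noteq> f \<and> (\<exists>k. entry_coord k e = entry_coord k f)"
proof -
  have agree: "(\<exists>k. entry_coord k e = entry_coord k f) \<longleftrightarrow>
      row_of e = row_of f \<or> col_of e = col_of f \<or> sym_of e = sym_of f" for e f :: "'s entry"
    unfolding ex_axis by simp
  show ?thesis
  proof
    assume "{e, f} \<in> snd (latin_square_graph n L)"
    then obtain e' f' where "{e, f} = {e', f'}" "e' \<in> entries n L" "f' \<in> entries n L" "e' \<noteq> f'"
      "\<exists>k. entry_coord k e' = entry_coord k f'"
      unfolding latin_square_graph_def agree by auto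
    then show "e \<in> entries n L \<and> f \<in> entries n L \<and> e \<noteq> f \<and> (\<exists>k. entry_coord k e = entry_coord k f)"
      unfolding doubleton_eq_iff by metis
  next
    assume "e \<in> entries n L \<and> f \<in> entries n L \<and> e \<noteq> f \<and> (\<exists>k. entry_coord k e = entry_coord k f)"
    then show "{e, f} \<in> snd (latin_square_graph n L)"
      unfolding latin_square_graph_def agree snd_conv mem_Collect_eq by blast
  qed
qed

text \<open>Two entries of \<open>C\<close> are adjacent when they agree on some axis, and then
  \<open>repeated_eq\<close> makes them the repeated pair of that axis.\<close>

lemma induced_graph_eq:
  assumes C: "C \<in> covers"
  shows "delete_isolated (induced_subgraph (latin_square_graph n L) C) = edge_graph (edges C)"
proof -
  have "{e \<in> snd (latin_square_graph n L). e \<subseteq> C} = edges C"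
  proof
    show "{e \<in> snd (latin_square_graph n L). e \<subseteq> C} \<subseteq> edges C"
    proof
      fix d assume d: "d \<in> {e \<in> snd (latin_square_graph n L). e \<subseteq> C}"
      then obtain e f where ef: "d = {e, f}" by (auto simp: latin_square_graph_def)
      then have "{e, f} \<in> snd (latin_square_graph n L)" "e \<in> C" "f \<in> C" using d by auto
      then obtain k where "e \<noteq> f" "entry_coord k e = entry_coord k f"
        unfolding latin_square_graph_edge_iff by blast
      then have "repeated C k = d"
        using repeated_eq(1)[OF C \<open>e \<in> C\<close> \<open>f \<in> C\<close>] ef by simp
      then show "d \<in> edges C" by blast
    qed
    show "edges C \<subseteq> {e \<in> snd (latin_square_graph n L). e \<subseteq> C}"
    proof
      fix d assume "d \<in> edges C"
      then obtain k where k: "d = repeated C k" by blast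
      obtain a b where ab: "a \<in> C" "b \<in> C" "a \<noteq> b" "entry_coord k a = entry_coord k b"
        "repeated C k = {a, b}"
        by (rule repeated_pair[OF C])
      have "a \<in> entries n L" "b \<in> entries n L" using ab(1,2) coversD(1)[OF C] by auto
      then have "{a, b} \<in> snd (latin_square_graph n L)"
        unfolding latin_square_graph_edge_iff using ab by blast
      then show "d \<in> {e \<in> snd (latin_square_graph n L). e \<subseteq> C}" using k ab by simp
    qed
  qed
  then have "induced_subgraph (latin_square_graph n L) C = (C, edges C)"
    by (simp add: induced_subgraph_def)
  moreover have "{v \<in> C. \<exists>e\<in>edges C. v \<in> e} = \<Union> (edges C)" using edges_subset[of C] by blast
  ultimately show ?thesis by (simp add: delete_isolated_def)
qed

lemma num_covers_eq: "num_covers n S L (n + 1) = card covers"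
  by (simp add: num_covers_def covers_def cover_iff)

lemma num_minimal_covers_eq: "num_minimal_covers n S L (n + 1) = card min_covers"
proof -
  have "{C. minimal_cover n S L C \<and> card C = n + 1} = min_covers"
    by (auto simp: minimal_cover_def min_covers_def covers_def cover_iff)
  then show ?thesis by (simp add: num_minimal_covers_def)
qed

lemma num_covers_of_type_eq: "num_covers_of_type n S L (n + 1) G = card (typed_covers G)"
proof -
  have "{C. cover n S L C \<and> card C = n + 1 \<and> graph_isomorphic
      (delete_isolated (induced_subgraph (latin_square_graph n L) C)) G} =
    {C \<in> covers. graph_isomorphic
      (delete_isolated (induced_subgraph (latin_square_graph n L) C)) G}"
    by (simp add: covers_def cover_iff)
  also have "\<dots> = typed_covers G"
    using induced_graph_eq by (auto simp: typed_covers_def)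
  finally show ?thesis by (simp add: num_covers_of_type_def)
qed

lemma num_transversals_eq: "num_transversals n S L = card transversals"
  by (simp add: num_transversals_def transversal_def partial_transversal_iff transversals_def)

lemma num_partial_transversals_eq: "num_partial_transversals n S L 1 = card near_transversals"
  by (simp add: num_partial_transversals_def partial_transversal_iff near_transversals_def)

lemma num_maximal_partial_transversals_eq:
  "num_maximal_partial_transversals n S L 1 = card max_near_transversals"
  unfolding num_maximal_partial_transversals_def maximal_partial_transversal_iff by simp

end

section \<open>The inequalities over the reals\<close>

theorem theorem2p7:
  fixes n :: nat and S :: "'s set" and L :: "nat \<Rightarrow> nat \<Rightarrow> 's"
    and p_max q_min q1 q2 q3 q5 t p q :: nat
  assumes "latin_square n S L" and "n \<ge> 3"
    and "p_max = num_maximal_partial_transversals n S L 1"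
    and "q_min = num_minimal_covers n S L (n + 1)"
    and "q1 = num_covers_of_type n S L (n + 1) G1"
    and "q2 = num_covers_of_type n S L (n + 1) G2"
    and "q3 = num_covers_of_type n S L (n + 1) G3"
    and "q5 = num_covers_of_type n S L (n + 1) G5"
    and "t = num_transversals n S L"
    and "p = num_partial_transversals n S L 1"
    and "q = num_covers n S L (n + 1)"
  shows "q_min = q1 + q2 + q3 + q5 \<and>
     0 \<le> 2 * (real q_min - real q1) / (3 * real n - 4) \<and>
     2 * (real q_min - real q1) / (3 * real n - 4) \<le> real p_max \<and>
     real p_max \<le> 2 * (real q_min - real q1) / (3 * real n - 6) \<and>
     2 * (real q_min - real q1) / (3 * real n - 6) \<le> 2 * real q_min / (3 * real n - 6) \<and>
     real p \<le> (2 * real q + real n * (real n - 4) * real t) / (3 * real n - 6)"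
proof -
  interpret latin_square_array n S L
    using assms(1,2) by unfold_locales auto
  note eqs = assms(3-11)[unfolded num_covers_eq num_minimal_covers_eq num_covers_of_type_eq
      num_transversals_eq num_partial_transversals_eq num_maximal_partial_transversals_eq]
  have qmin: "q_min = q1 + q2 + q3 + q5"
    using card_min_covers eqs by simp
  have c: "2 * q2 + 3 * (q3 + q5) + 3 * p_max = 3 * n * p_max" "p_max \<le> q3 + q5" "q3 + q5 \<le> 3 * p_max"
    using max_near_transversals_count eqs by simp_all
  have "real (2 * q2 + 3 * (q3 + q5) + 3 * p_max) = real (3 * n * p_max)" using c(1) by (rule arg_cong)
  then have count: "2 * real q2 + 3 * (real q3 + real q5) + 3 * real p_max = 3 * real n * real p_max"
    "real p_max \<le> real q3 + real q5" "real q3 + real q5 \<le> 3 * real p_max"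
    using c(2,3) by simp_all
  have "p \<le> p_max + n * t" using near_transversals_bound eqs by simp
  then have p: "real p \<le> real p_max + real n * real t" by (metis of_nat_add of_nat_le_iff of_nat_mult)
  \<comment> \<open>This lets the natural-number difference \<open>n * n - n\<close> pass to the
    reals.\<close>
  have "n \<le> n * n" by simp
  have "q_min + t * (n * n - n) \<le> q" using covers_bound eqs by simp
  then have "real (q_min + t * (n * n - n)) \<le> real q" by (simp only: of_nat_le_iff)
  then have q: "real q_min + real t * (real n * real n - real n) \<le> real q"
    using \<open>n \<le> n * n\<close> by (simp add: of_nat_diff)
  have n: "3 * real n - 4 > 0" "3 * real n - 6 > 0" using assms(2) by simp_all
  have diff: "real q_min - real q1 = real q2 + real q3 + real q5" using qmin by simp
  \<comment> \<open>With \<open>c = q3 + q5\<close>, the count reads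
    \<open>2 * (q2 + c) = (3 * n - 3) * p_max - c\<close>. The bounds \<open>p_max \<le> c\<close>
    and \<open>c \<le> 3 * p_max\<close> then give \<open>lo\<close> and \<open>hi\<close>.\<close>
  have lo: "2 * (real q_min - real q1) \<le> real p_max * (3 * real n - 4)"
    unfolding diff using count by (simp add: algebra_simps)
  have hi: "real p_max * (3 * real n - 6) \<le> 2 * (real q_min - real q1)"
    unfolding diff using count by (simp add: algebra_simps)
  have "real p * (3 * real n - 6) \<le> (real p_max + real n * real t) * (3 * real n - 6)"
    using p n by (intro mult_right_mono) auto
  also have "\<dots> \<le> 2 * real q_min + real n * real t * (3 * real n - 6)"
    using hi by (simp add: algebra_simps)
  \<comment> \<open>The bound on \<open>q_min\<close> costs \<open>2 * (n * n - n) * t\<close>, and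
    \<open>n * (3 * n - 6) - 2 * (n * n - n) = n * (n - 4)\<close>.\<close>
  also have "\<dots> \<le> 2 * real q + real n * (real n - 4) * real t"
    using q by (simp add: algebra_simps)
  finally have last: "real p * (3 * real n - 6) \<le> 2 * real q + real n * (real n - 4) * real t" .
  show ?thesis
    using qmin n lo hi last diff by (simp add: pos_divide_le_eq pos_le_divide_eq divide_right_mono)
qed

end
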